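(* Let $f$ be a log-concave probability density on $\mathbb{R}$ with distribution function $F$, and for each $n>1$ let $\hat f_n$ be the log-concave maximum likelihood density estimator based on a random sample of size $n$ from $f$, with distribution function $\hat F_n$. Then, as $n\to\infty$, $$\int_{\mathbb{R}}|\hat f_n(x)-f(x)|\,dx\to_{\mathrm p}0\quad\text{and}\quad\sup_{x\in\mathbb{R}}|\hat F_n(x)-F(x)|\to_{\mathrm p}0.$$
   Context: A probability density $f$ on $\mathbb{R}$ is log-concave if $f=\exp\varphi$ for some concave $\varphi:\mathbb{R}\to[-\infty,\infty)$ (with $\exp(-\infty)=0$). For each $n>1$, let $X_1<X_2<\dots<X_n$ be the order statistics of an i.i.d. sample of size $n$ from $f$ (almost surely distinct), with empirical distribution function $\mathbb{F}_n$. For concave $\varphi:\mathbb{R}\to[-\infty,\infty)$ put $\Psi_n(\varphi):=\int\varphi\,d\mathbb{F}_n-\int_{\mathbb{R}}\exp\varphi(x)\,dx$. The estimator $\hat\varphi_n$ is the maximizer of $\Psi_n$ over all concave functions $\mathbb{R}\to[-\infty,\infty)$. It is known that it exists, is unique, is linear on each $[X_j,X_{j+1}]$, $1\le j<n$, and equals $-\infty$ on $\mathbb{R}\setminus[X_1,X_n]$. Put $\hat f_n:=\exp\hat\varphi_n$ and $\hat F_n(x):=\int_{-\infty}^x\hat f_n(r)\,dr$. $\to_{\mathrm p}$ denotes convergence in probability. *)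

theory Defs
  imports "HOL-Probability.Probability"
begin

definition concave_ext :: "(real \<Rightarrow> ereal) \<Rightarrow> bool" where
  "concave_ext \<phi> \<longleftrightarrow>
     (\<forall>x. \<phi> x < \<infinity>) \<and>
     (\<forall>x y t. 0 \<le> t \<and> t \<le> 1 \<longrightarrow>
        ereal (1 - t) * \<phi> x + ereal t * \<phi> y \<le> \<phi> ((1 - t) * x + t * y))"

(* Only arguments in [-\<infinity>, \<infinity>) are meant; the value at \<infinity> is irrelevant. *)
definition exp_ext :: "ereal \<Rightarrow> real" where
  "exp_ext y = (if y = -\<infinity> then 0 else exp (real_of_ereal y))"

definition log_concave :: "(real \<Rightarrow> real) \<Rightarrow> bool" where
  "log_concave f \<longleftrightarrow> (\<exists>\<phi>. concave_ext \<phi> \<and> f = (\<lambda>x. exp_ext (\<phi> x)))"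

definition prob_density :: "(real \<Rightarrow> real) \<Rightarrow> bool" where
  "prob_density f \<longleftrightarrow> (\<forall>x. 0 \<le> f x) \<and> has_bochner_integral lborel f 1"

definition dist_fun :: "(real \<Rightarrow> real) \<Rightarrow> real \<Rightarrow> real" where
  "dist_fun f x = (LINT r:{..x}|lborel. f r)"

(* The integral of \<phi> against the empirical distribution of x 0, ..., x (n - 1) is the
   average of \<phi> over the sample; it does not depend on the order of the sample.  The value
   is -\<infinity> if \<phi> is -\<infinity> at a sample point or if exp \<phi> has infinite integral. *)
definition log_lik :: "nat \<Rightarrow> (nat \<Rightarrow> real) \<Rightarrow> (real \<Rightarrow> ereal) \<Rightarrow> ereal" where
  "log_lik n x \<phi> =
     (\<Sum>i<n. \<phi> (x i)) / ereal (real n)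
       - enn2ereal (\<integral>\<^sup>+ r. ennreal (exp_ext (\<phi> r)) \<partial>lborel)"

definition is_log_concave_mle :: "nat \<Rightarrow> (nat \<Rightarrow> real) \<Rightarrow> (real \<Rightarrow> ereal) \<Rightarrow> bool" where
  "is_log_concave_mle n x \<phi> \<longleftrightarrow>
     concave_ext \<phi> \<and> (\<forall>\<psi>. concave_ext \<psi> \<longrightarrow> log_lik n x \<psi> \<le> log_lik n x \<phi>)"

(* Outer measure coincides with the measure on measurable sets.  The plain measure would
   be 0 on a non-measurable set, so it could make the convergence hold for free. *)
definition tendsto_in_prob :: "'a measure \<Rightarrow> (nat \<Rightarrow> 'a \<Rightarrow> real) \<Rightarrow> real \<Rightarrow> bool" where
  "tendsto_in_prob M Z c \<longleftrightarrow>
     (\<forall>\<epsilon>>0. (\<lambda>n. outer_measure_of M {\<omega> \<in> space M. \<bar>Z n \<omega> - c\<bar> > \<epsilon>}) \<longlonglongrightarrow> 0)"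

end

theory Submission
  imports Defs
begin

text \<open>
  Adding a constant to the log-density shows that the estimator \<open>g\<close> is a probability density, and
  by maximality the sample average of \<open>ln g\<close> is at least that of \<open>ln f\<close>, which is close to
  \<open>\<integral> f ln f\<close> by Chebyshev's inequality. The function \<open>ln (g + \<epsilon>)\<close> is quasi-concave with
  values in \<open>[ln \<epsilon>, ln (C + 1)]\<close>, where \<open>C\<close> is an a priori bound for \<open>g\<close>. As the empirical measure
  of every interval is, uniformly, at most slightly more than its \<open>f\<close>-measure, the sample average of
  \<open>ln (g + \<epsilon>)\<close> is at most \<open>\<integral> f ln (g + \<epsilon>)\<close> plus a small error. Hence
  \<open>\<integral> f ln (f / (g + \<epsilon>))\<close> is small; it dominates the squared Hellinger distance of \<open>f\<close> and \<open>g\<close> up to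
  \<open>2 sqrt \<epsilon> \<integral> sqrt f\<close>, which is finite because \<open>f\<close> has exponential tails. The Hellinger
  distance controls the \<open>L\<^sup>1\<close> distance, which in turn controls the distance of the distribution
  functions.
\<close>

subsection \<open>Log-concave functions\<close>

lemma log_concave_nonneg: "log_concave g \<Longrightarrow> 0 \<le> g x"
  by (auto simp: log_concave_def exp_ext_def)

text \<open>Concavity in terms of real logarithms. Where \<open>g\<close> is positive the exponents
  are real, and concavity bounds the intermediate exponent below by a real number, so it cannot be
  \<open>-\<infinity>\<close>.\<close>

lemma log_concaveD:
  assumes "log_concave g" "0 < g x" "0 < g y" "0 \<le> t" "t \<le> 1"
  shows "0 < g ((1 - t) * x + t * y)"
    and "(1 - t) * ln (g x) + t * ln (g y) \<le> ln (g ((1 - t) * x + t * y))"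
proof -
  obtain \<phi> where \<phi>: "concave_ext \<phi>" and g: "g = (\<lambda>x. exp_ext (\<phi> x))"
    using assms(1) by (auto simp: log_concave_def)
  have real: "\<exists>r. \<phi> z = ereal r" if "\<phi> z \<noteq> -\<infinity>" for z
    using that \<phi> unfolding concave_ext_def by (cases "\<phi> z") force+
  obtain a b where ab: "\<phi> x = ereal a" "\<phi> y = ereal b"
    using real[of x] real[of y] assms(2,3) by (auto simp: g exp_ext_def split: if_splits)
  let ?z = "(1 - t) * x + t * y"
  have le: "ereal ((1 - t) * a + t * b) \<le> \<phi> ?z"
    using \<phi> assms(4,5) ab unfolding concave_ext_def
    by (metis plus_ereal.simps(1) times_ereal.simps(1))
  then have "\<phi> ?z \<noteq> -\<infinity>" by auto
  then obtain c where c: "\<phi> ?z = ereal c" using real by blast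
  show "0 < g ?z" "(1 - t) * ln (g x) + t * ln (g y) \<le> ln (g ?z)"
    using le by (simp_all add: g exp_ext_def ab c)
qed

lemma log_concave_uminus:
  assumes "log_concave g"
  shows "log_concave (\<lambda>x. g (- x))"
proof -
  obtain \<phi> where \<phi>: "concave_ext \<phi>" and g: "g = (\<lambda>x. exp_ext (\<phi> x))"
    using assms by (auto simp: log_concave_def)
  have "ereal (1 - t) * \<phi> (- x) + ereal t * \<phi> (- y) \<le> \<phi> (- ((1 - t) * x + t * y))"
    if "0 \<le> t" "t \<le> 1" for x y t
  proof -
    have "(1 - t) * (- x) + t * (- y) = - ((1 - t) * x + t * y)" by (simp add: algebra_simps)
    then show ?thesis using \<phi> that unfolding concave_ext_def by metis
  qed
  then have "concave_ext (\<lambda>x. \<phi> (- x))" using \<phi> by (auto simp: concave_ext_def)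
  then show ?thesis using g by (auto simp: log_concave_def)
qed

lemma log_concave_ge_min:
  assumes g: "log_concave g" and "x \<le> z" "z \<le> y"
  shows "min (g x) (g y) \<le> g z"
proof (cases "x = y \<or> g x = 0 \<or> g y = 0")
  case True
  then show ?thesis using assms log_concave_nonneg[OF g, of z] by (auto simp: min_le_iff_disj)
next
  case False
  define t where "t = (z - x) / (y - x)"
  have "(1 - t) * x + t * y = x + t * (y - x)" by (simp add: algebra_simps)
  then have t: "0 \<le> t" "t \<le> 1" "(1 - t) * x + t * y = z"
    using False assms by (auto simp: t_def)
  have pos: "0 < g x" "0 < g y" using False log_concave_nonneg[OF g] by (auto simp: less_le)
  note D = log_concaveD[OF g pos t(1,2), unfolded t(3)]
  let ?m = "min (ln (g x)) (ln (g y))"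
  have "(1 - t) * ?m + t * ?m \<le> (1 - t) * ln (g x) + t * ln (g y)"
    using t by (intro add_mono mult_left_mono) auto
  then have "?m \<le> ln (g z)" using D(2) by (simp add: algebra_simps)
  then show ?thesis using pos D(1) by (auto simp: min_def split: if_splits)
qed

text \<open>Quasi-concavity makes the superlevel sets intervals. This yields Borel measurability,
  and later lets uniform control of the empirical measure on intervals control averages of functions
  of \<open>g\<close>.\<close>

lemma convex_superlevel_log_concave:
  assumes "log_concave g"
  shows "convex {x. a < g x}"
  unfolding is_interval_convex_1[symmetric] is_interval_1
proof (intro allI ballI impI)
  fix x y z assume "x \<in> {x. a < g x}" "y \<in> {x. a < g x}" "x \<le> z \<and> z \<le> y"
  then show "z \<in> {x. a < g x}" using log_concave_ge_min[OF assms, of x z y] by auto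
qed

lemma convex_real_borel: "convex (S :: real set) \<Longrightarrow> S \<in> sets borel"
  by (simp add: real_interval_borel_measurable is_interval_convex_1)

lemma borel_measurable_log_concave: "log_concave g \<Longrightarrow> g \<in> borel_measurable borel"
  using convex_superlevel_log_concave convex_real_borel
  by (intro borel_measurableI_greater) auto

section \<open>Exponential tails from chords of the log-density\<close>

lemma log_concave_chord:
  assumes g: "log_concave g" and p: "0 < g p" and t: "0 < t" "t \<le> 1"
  shows "g x \<le> g p * (g (p + t * (x - p)) / g p) powr (1 / t)"
proof (cases "g x = 0")
  case True
  then show ?thesis using p by simp
next
  case False
  then have x: "0 < g x" using log_concave_nonneg[OF g, of x] by simp
  have e: "(1 - t) * p + t * x = p + t * (x - p)" by (simp add: algebra_simps)
  \<comment> \<open>The intermediate point lies on the segment from \<open>p\<close> to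
    \<open>x\<close>; solving the concavity inequality for \<open>ln (g x)\<close> extrapolates the
    chord from \<open>p\<close> through that point out to \<open>x\<close>.\<close>
  note D = log_concaveD[OF g p x less_imp_le[OF t(1)] t(2), unfolded e]
  let ?m = "p + t * (x - p)"
  have "ln (g x) \<le> ln (g p) + 1 / t * (ln (g ?m) - ln (g p))"
    using D(2) t by (simp add: field_simps)
  also have "\<dots> = ln (g p * (g ?m / g p) powr (1 / t))"
    using p D(1) t by (simp add: ln_mult ln_powr ln_div)
  finally show ?thesis using x p D(1) by simp
qed

text \<open>Integrability forces some \<open>R > m\<close> with \<open>g R < g p\<close>. The chord
  from \<open>p\<close> through \<open>R\<close> then descends and gives geometric decay beyond
  \<open>R\<close>, while the chord from \<open>p\<close> through \<open>m\<close> bounds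
  \<open>g\<close> on the compact rest.\<close>

lemma log_concave_right_tail:
  assumes g: "log_concave g" and int: "integrable lborel g"
    and pm: "p < m" "0 < g p" "0 < g m"
  shows "\<exists>a>0. \<exists>b>0. \<forall>x\<ge>m. g x \<le> a * exp (- b * x)"
proof -
  have chord: "g x \<le> g p * (g q / g p) powr ((x - p) / (q - p))" if "p < q" "q \<le> x" for q x
    using log_concave_chord[OF g pm(2), of "(q - p) / (x - p)" x] that by simp
  obtain R where R: "m < R" "g R < g p"
  proof -
    \<comment> \<open>On an interval of length \<open>L\<close> the constant \<open>g p\<close> has
      integral one more than that of \<open>g\<close>.\<close>
    define L where "L = (integral\<^sup>L lborel g + 1) / g p"
    have I: "0 \<le> integral\<^sup>L lborel g" using log_concave_nonneg[OF g] by (simp add: integral_nonneg)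
    have "\<exists>R. m < R \<and> g R < g p"
    proof (rule ccontr)
      assume "\<not> ?thesis"
      then have *: "g p \<le> g R" if "m < R" for R using that by (meson not_less)
      have "(LINT x|lborel. g p * indicator {m<..m+L} x) \<le> integral\<^sup>L lborel g"
      proof (intro integral_mono int)
        show "integrable lborel (\<lambda>x. g p * indicator {m<..m+L} x)"
          by (intro integrable_mult_right integrable_real_indicator emeasure_bounded_finite) auto
        show "g p * indicator {m<..m+L} x \<le> g x" for x
          using * log_concave_nonneg[OF g, of x] by (cases "x \<in> {m<..m+L}") (auto simp: not_less)
      qed
      moreover have "0 \<le> L" using I pm by (auto simp: L_def)
      ultimately have "g p * L \<le> integral\<^sup>L lborel g" by simp
      then show False using pm by (simp add: L_def)
    qed
    then show ?thesis using that by blast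
  qed
  \<comment> \<open>The lower bound 1/2 keeps the ratio positive, so that its logarithm makes sense
    even if \<open>g R = 0\<close>.\<close>
  define \<rho> where "\<rho> = max (g R / g p) (1 / 2)"
  have \<rho>: "0 < \<rho>" "\<rho> < 1" using R pm by (auto simp: \<rho>_def)
  define b where "b = - ln \<rho> / (R - p)"
  have b: "0 < b" using \<rho> R pm by (auto simp: b_def intro!: divide_neg_pos)
  define A1 where "A1 = g p * exp (b * p)"
  \<comment> \<open>The chord through \<open>m\<close> may ascend; raising its base to at least 1
    makes the power largest at \<open>x = R\<close>.\<close>
  define k where "k = max 1 (g m / g p) powr ((R - p) / (m - p))"
  define A2 where "A2 = g p * k * exp (b * R)"
  have tail: "g x \<le> A1 * exp (- b * x)" if "R \<le> x" for x
  proof -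
    have "g x \<le> g p * (g R / g p) powr ((x - p) / (R - p))" using chord R pm that by simp
    also have "\<dots> \<le> g p * \<rho> powr ((x - p) / (R - p))"
      using pm log_concave_nonneg[OF g] R that
      by (intro mult_left_mono powr_mono2) (auto simp: \<rho>_def)
    also have "\<dots> = A1 * exp (- b * x)"
      using \<rho> R pm unfolding A1_def b_def powr_def
      by (simp add: exp_add[symmetric] diff_divide_distrib algebra_simps)
    finally show ?thesis .
  qed
  have mid: "g x \<le> A2 * exp (- b * x)" if "m \<le> x" "x \<le> R" for x
  proof -
    have "g x \<le> g p * (g m / g p) powr ((x - p) / (m - p))" using chord pm that by simp
    also have "\<dots> \<le> g p * max 1 (g m / g p) powr ((x - p) / (m - p))"
      using pm that by (intro mult_left_mono powr_mono2) auto
    also have "\<dots> \<le> g p * k"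
      unfolding k_def using pm that by (intro mult_left_mono powr_mono divide_right_mono) auto
    also have "\<dots> \<le> g p * k * exp (b * R - b * x)"
    proof -
      have "1 \<le> exp (b * R - b * x)" using b that by (simp add: mult_left_mono)
      then show ?thesis using mult_left_mono[of 1 _ "g p * k"] pm by (simp add: k_def)
    qed
    also have "\<dots> = A2 * exp (- b * x)" by (simp add: A2_def exp_diff exp_minus field_simps)
    finally show ?thesis .
  qed
  have A: "0 < A1" "0 < A2" using pm by (auto simp: A1_def A2_def k_def)
  have "g x \<le> (A1 + A2) * exp (- b * x)" if "m \<le> x" for x
    using tail[of x] mid[of x] that A by (cases "R \<le> x") (simp_all add: distrib_right add_increasing add_increasing2)
  then show ?thesis using A b by (intro exI[of _ "A1 + A2"]) auto
qed

lemma log_concave_exp_bound: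
  assumes g: "log_concave g" and int: "integrable lborel g" and pos: "0 < integral\<^sup>L lborel g"
  shows "\<exists>a>0. \<exists>b>0. \<forall>x. g x \<le> a * exp (- b * \<bar>x\<bar>)"
proof -
  \<comment> \<open>A function that is positive at no more than one point has integral 0.\<close>
  have "\<exists>p q. p < q \<and> 0 < g p \<and> 0 < g q"
  proof (rule ccontr)
    assume *: "\<not> ?thesis"
    have "\<exists>p. \<forall>x. x \<noteq> p \<longrightarrow> g x = 0"
      using * log_concave_nonneg[OF g] by (metis less_le linorder_neqE_linordered_idom)
    then obtain p where p: "\<And>x. x \<noteq> p \<Longrightarrow> g x = 0" by blast
    have "AE x in lborel. g x = 0" using AE_lborel_singleton[of p] by eventually_elim (use p in auto)
    then have "integral\<^sup>L lborel g = 0" by (rule integral_eq_zero_AE)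
    then show False using pos by simp
  qed
  then obtain p q where pq: "p < q" "0 < g p" "0 < g q" by blast
  define m where "m = (p + q) / 2"
  have "min (g p) (g q) \<le> g m" using pq by (intro log_concave_ge_min[OF g]) (auto simp: m_def)
  then have m: "p < m" "m < q" "0 < g m" using pq by (auto simp: m_def)
  obtain a1 b1 where 1: "0 < a1" "0 < b1" "\<And>x. m \<le> x \<Longrightarrow> g x \<le> a1 * exp (- b1 * x)"
    using log_concave_right_tail[OF g int m(1)] pq m by blast
  \<comment> \<open>The left tail is the right tail of the reflected function.\<close>
  have "\<exists>a>0. \<exists>b>0. \<forall>x\<ge>-m. g (- x) \<le> a * exp (- b * x)"
    using pq m int lborel_integrable_real_affine_iff[of "-1" g 0]
    by (intro log_concave_right_tail[of _ "-q"] log_concave_uminus g) auto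
  then obtain a2 b2 where 2: "0 < a2" "0 < b2" "\<And>x. -m \<le> x \<Longrightarrow> g (- x) \<le> a2 * exp (- b2 * x)"
    by blast
  define b where "b = min b1 b2"
  define a where "a = a1 * exp (2 * b1 * \<bar>m\<bar>) + a2 * exp (2 * b2 * \<bar>m\<bar>)"
  \<comment> \<open>For \<open>x \<ge> n\<close> the difference of \<open>\<bar>x\<bar>\<close> and
    \<open>x\<close> is at most \<open>2 * \<bar>n\<bar>\<close>, so one-sided decay in
    \<open>x\<close> becomes decay in \<open>\<bar>x\<bar>\<close> at the price of a constant
    factor. It serves both tails, with \<open>n = m\<close> and \<open>n = -m\<close>.\<close>
  have ineq: "- c * x \<le> 2 * c * \<bar>n\<bar> - b * \<bar>x\<bar>" if "n \<le> x" "b \<le> c" "0 < c" for c x n :: real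
  proof -
    have "b * \<bar>x\<bar> \<le> c * \<bar>x\<bar>" using that by (intro mult_right_mono) auto
    moreover have "c * (\<bar>x\<bar> - x) \<le> c * (2 * \<bar>n\<bar>)" using that by (intro mult_left_mono) auto
    ultimately show ?thesis by (simp add: algebra_simps)
  qed
  have half: "c * exp (- d * x) \<le> c * exp (2 * d * \<bar>n\<bar>) * exp (- b * \<bar>x\<bar>)"
    if "n \<le> x" "b \<le> d" "0 < d" "0 < c" for c d x n :: real
    using ineq[OF that(1-3)] that(4) by (simp add: exp_add[symmetric] mult.assoc)
  have "g x \<le> a * exp (- b * \<bar>x\<bar>)" for x
  proof (cases "m \<le> x")
    case True
    have "g x \<le> a1 * exp (2 * b1 * \<bar>m\<bar>) * exp (- b * \<bar>x\<bar>)"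
      using 1(3)[OF True] half[of m x b1 a1, OF True _ 1(2,1)] by (simp add: b_def)
    then show ?thesis using 2 by (simp add: a_def distrib_right add_increasing2)
  next
    case False
    have "g (- (- x)) \<le> a2 * exp (2 * b2 * \<bar>m\<bar>) * exp (- b * \<bar>x\<bar>)"
      using 2(3)[of "- x"] half[of "-m" "-x" b2 a2, OF _ _ 2(2,1)] False by (simp add: b_def)
    then show ?thesis using 1 by (simp add: a_def distrib_right add_increasing)
  qed
  moreover have "0 < a" "0 < b" using 1 2 by (auto simp: a_def b_def intro!: add_pos_pos)
  ultimately show ?thesis by blast
qed

lemma integrable_exp_neg_abs:
  fixes b :: real assumes b: "0 < b"
  shows "integrable lborel (\<lambda>x. exp (- b * \<bar>x\<bar>))"
proof -
  interpret prob_space "density lborel (exponential_density b)"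
    using prob_space_exponential_density[OF b] .
  have "integrable (density lborel (exponential_density b)) (\<lambda>_. 1 :: real)" by simp
  then have 1: "integrable lborel (exponential_density b)"
    using b by (subst (asm) integrable_density) (auto simp: exponential_density_nonneg)
  then have 2: "integrable lborel (\<lambda>x. exponential_density b (- x))"
    using lborel_integrable_real_affine_iff[of "-1" "exponential_density b" 0] by simp
  show ?thesis
    using Bochner_Integration.integrable_add[OF 1 2, THEN integrable_mult_right, of "1 / b"]
    by (rule Bochner_Integration.integrable_bound)
       (use b in \<open>auto simp: exponential_density_def field_simps\<close>)
qed

subsection \<open>The likelihood equation\<close>

lemma nn_integral_exp_ext:
  assumes "concave_ext \<phi>" and "(\<integral>\<^sup>+ r. ennreal (exp_ext (\<phi> r)) \<partial>lborel) \<noteq> \<infinity>"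
  shows "integrable lborel (\<lambda>r. exp_ext (\<phi> r))"
    and "(\<integral>\<^sup>+ r. ennreal (exp_ext (\<phi> r)) \<partial>lborel) = ennreal (LINT r|lborel. exp_ext (\<phi> r))"
proof -
  have lc: "log_concave (\<lambda>r. exp_ext (\<phi> r))" using assms by (auto simp: log_concave_def)
  note m = borel_measurable_log_concave[OF lc] and n = log_concave_nonneg[OF lc]
  show "integrable lborel (\<lambda>r. exp_ext (\<phi> r))"
    using m n assms(2) by (intro integrableI_nonneg) (auto simp: top.not_eq_extremum)
  then show "(\<integral>\<^sup>+ r. ennreal (exp_ext (\<phi> r)) \<partial>lborel) = ennreal (LINT r|lborel. exp_ext (\<phi> r))"
    using n by (intro nn_integral_eq_integral) auto
qed

lemma log_lik_real:
  assumes \<phi>: "concave_ext \<phi>" and int: "integrable lborel (\<lambda>r. exp_ext (\<phi> r))"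
    and pos: "\<And>i. i < n \<Longrightarrow> 0 < exp_ext (\<phi> (x i))" and n: "0 < n"
  shows "log_lik n x \<phi> =
    ereal ((\<Sum>i<n. ln (exp_ext (\<phi> (x i)))) / real n - (LINT r|lborel. exp_ext (\<phi> r)))"
proof -
  have nonneg: "0 \<le> exp_ext (\<phi> r)" for r by (simp add: exp_ext_def)
  have "\<phi> (x i) = ereal (ln (exp_ext (\<phi> (x i))))" if "i < n" for i
    using pos[OF that] \<phi> by (cases "\<phi> (x i)") (auto simp: exp_ext_def concave_ext_def less_top[symmetric])
  then have "(\<Sum>i<n. \<phi> (x i)) = ereal (\<Sum>i<n. ln (exp_ext (\<phi> (x i))))"
    by (simp add: sum_ereal[symmetric] del: sum_ereal)
  moreover have "(\<integral>\<^sup>+ r. ennreal (exp_ext (\<phi> r)) \<partial>lborel) = ennreal (LINT r|lborel. exp_ext (\<phi> r))"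
    using int nonneg by (intro nn_integral_eq_integral) auto
  ultimately show ?thesis
    using n nonneg by (simp add: log_lik_def integral_nonneg)
qed

lemma concave_ext_add_const:
  assumes "concave_ext \<phi>"
  shows "concave_ext (\<lambda>x. \<phi> x + ereal c)"
proof -
  have "ereal (1 - t) * (\<phi> x + ereal c) + ereal t * (\<phi> y + ereal c)
        \<le> \<phi> ((1 - t) * x + t * y) + ereal c" if t: "0 \<le> t" "t \<le> 1" for x y t
  proof -
    have "ereal (1 - t) * (\<phi> x + ereal c) + ereal t * (\<phi> y + ereal c)
        = ereal (1 - t) * \<phi> x + ereal t * \<phi> y + ereal c"
      \<comment> \<open>The endpoints \<open>t = 0\<close> and \<open>t = 1\<close> are separate
        because zero times \<open>-\<infinity>\<close> is 0 in \<open>ereal\<close>, whereas a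
        positive multiple is \<open>-\<infinity>\<close>.\<close>
      using t by (cases "\<phi> x"; cases "\<phi> y"; cases "t = 0"; cases "t = 1") (auto simp: algebra_simps)
    then show ?thesis using assms t by (auto simp: concave_ext_def intro!: add_right_mono)
  qed
  moreover have "\<phi> x + ereal c < \<infinity>" for x using assms by (auto simp: concave_ext_def)
  ultimately show ?thesis by (auto simp: concave_ext_def)
qed

lemma exp_ext_add_const: "y < \<infinity> \<Longrightarrow> exp_ext (y + ereal c) = exp c * exp_ext y"
  by (cases y) (auto simp: exp_ext_def exp_add)

text \<open>The true log-density is a competitor with finite likelihood, so the maximum is not
  \<open>-\<infinity>\<close>; this makes the integral finite and the sample values positive.
  Shifting by a constant then normalises the integral, after which the penalty terms of both
  competitors equal 1 and cancel.\<close>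

lemma log_concave_mle_properties:
  assumes mle: "is_log_concave_mle n x \<phi>" and n: "0 < n"
    and f: "log_concave f" "prob_density f" and pos: "\<And>i. i < n \<Longrightarrow> 0 < f (x i)"
  shows "prob_density (\<lambda>r. exp_ext (\<phi> r))"
    and "\<And>i. i < n \<Longrightarrow> 0 < exp_ext (\<phi> (x i))"
    and "(\<Sum>i<n. ln (f (x i))) \<le> (\<Sum>i<n. ln (exp_ext (\<phi> (x i))))"
proof -
  let ?g = "\<lambda>r. exp_ext (\<phi> r)"
  have \<phi>: "concave_ext \<phi>" and max: "\<And>\<psi>. concave_ext \<psi> \<Longrightarrow> log_lik n x \<psi> \<le> log_lik n x \<phi>"
    using mle by (auto simp: is_log_concave_mle_def)
  obtain \<psi> where \<psi>: "concave_ext \<psi>" "f = (\<lambda>x. exp_ext (\<psi> x))" using f by (auto simp: log_concave_def)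
  have f1: "integrable lborel f" "integral\<^sup>L lborel f = 1"
    using f(2) by (auto simp: prob_density_def has_bochner_integral_iff)
  have lik_f: "log_lik n x \<psi> = ereal ((\<Sum>i<n. ln (f (x i))) / real n - 1)"
    using log_lik_real[OF \<psi>(1), of n x] n f1 pos by (simp add: \<psi>(2))
  have fin: "log_lik n x \<phi> \<noteq> -\<infinity>" using max[OF \<psi>(1)] lik_f by auto
  have lt: "\<phi> r < \<infinity>" for r using \<phi> by (auto simp: concave_ext_def)
  have sum_lt: "(\<Sum>i\<in>I. \<phi> (x i)) \<noteq> \<infinity>" for I using lt by (subst sum_Pinfty) auto
  have div_lt: "(\<Sum>i<n. \<phi> (x i)) / ereal (real n) \<noteq> \<infinity>"
    using sum_lt[of "{..<n}"] n by (cases "\<Sum>i<n. \<phi> (x i)") auto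
  have int_fin: "(\<integral>\<^sup>+ r. ennreal (?g r) \<partial>lborel) \<noteq> \<infinity>"
  proof
    assume "(\<integral>\<^sup>+ r. ennreal (?g r) \<partial>lborel) = \<infinity>"
    then have "log_lik n x \<phi> = -\<infinity>"
      using div_lt by (cases "(\<Sum>i<n. \<phi> (x i)) / ereal (real n)") (auto simp: log_lik_def)
    then show False using fin by simp
  qed
  note int = nn_integral_exp_ext[OF \<phi> int_fin]
  show gpos: "0 < ?g (x i)" if "i < n" for i
  proof (rule ccontr)
    assume "\<not> ?thesis"
    then have "\<phi> (x i) = -\<infinity>" by (auto simp: exp_ext_def split: if_splits)
    then have "(\<Sum>i<n. \<phi> (x i)) = -\<infinity>"
      using that sum_lt[of "{..<n} - {i}"] by (subst sum.remove[of _ i]) auto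
    moreover have "0 \<le> (LINT r|lborel. ?g r)" by (simp add: integral_nonneg exp_ext_def)
    ultimately have "log_lik n x \<phi> = -\<infinity>" using n int(2) by (simp add: log_lik_def)
    then show False using fin by simp
  qed
  define v where "v = (LINT r|lborel. ?g r)"
  define a where "a = (\<Sum>i<n. ln (?g (x i))) / real n"
  have v0: "0 \<le> v" unfolding v_def by (simp add: integral_nonneg exp_ext_def)
  have lik: "log_lik n x \<phi> = ereal (a - v)"
    using log_lik_real[OF \<phi> int(1) gpos n] by (simp add: a_def v_def)
  have shift: "a + c - exp c * v \<le> a - v" for c
  proof -
    have e: "exp_ext (\<phi> r + ereal c) = exp c * ?g r" for r using exp_ext_add_const lt by simp
    have "ln (exp c * ?g (x i)) = c + ln (?g (x i))" if "i < n" for i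
      using gpos[OF that] by (simp add: ln_mult)
    then have "(\<Sum>i<n. ln (exp c * ?g (x i))) = real n * c + (\<Sum>i<n. ln (?g (x i)))"
      by (simp add: sum.distrib)
    then have "log_lik n x (\<lambda>r. \<phi> r + ereal c) = ereal (a + c - exp c * v)"
      using log_lik_real[OF concave_ext_add_const[OF \<phi>], of c n x] gpos n int(1)
      by (simp add: e a_def v_def add_divide_distrib)
    then show ?thesis using max[OF concave_ext_add_const[OF \<phi>, of c]] lik by simp
  qed
  \<comment> \<open>With no mass, the shift by 1 would raise the likelihood by 1.\<close>
  have "v \<noteq> 0" using shift[of 1] by auto
  then have v: "0 < v" using v0 by simp
  have "v = 1"
  proof -
    \<comment> \<open>The shift by \<open>- ln v\<close> normalises the mass. Its inequality
      reverses \<open>ln v \<le> v - 1\<close>, which is an equality only at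
      \<open>v = 1\<close>.\<close>
    have "v - 1 \<le> ln v" using shift[of "- ln v"] v by (simp add: exp_minus)
    then have "ln v = v - 1" using ln_le_minus_one[OF v] by simp
    then show ?thesis using ln_eq_minus_one v by blast
  qed
  then show "prob_density ?g"
    using int(1) by (auto simp: prob_density_def has_bochner_integral_iff v_def exp_ext_def)
  show "(\<Sum>i<n. ln (f (x i))) \<le> (\<Sum>i<n. ln (?g (x i)))"
    using max[OF \<psi>(1)] lik lik_f \<open>v = 1\<close> n by (simp add: a_def divide_le_cancel)
qed

subsection \<open>Averages of quasi-concave functions\<close>

lemma prob_densityD:
  assumes "prob_density f"
  shows "0 \<le> f x" "integrable lborel f" "f \<in> borel_measurable borel" "integral\<^sup>L lborel f = 1"
  using assms by (auto simp: prob_density_def has_bochner_integral_iff)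

lemma integrable_density_times_bounded:
  fixes h :: "real \<Rightarrow> real"
  assumes f: "prob_density f" and h: "h \<in> borel_measurable borel" "\<And>y. \<bar>h y\<bar> \<le> K"
  shows "integrable lborel (\<lambda>y. f y * h y)"
proof (rule Bochner_Integration.integrable_bound)
  show "integrable lborel (\<lambda>y. f y * K)" using prob_densityD[OF f] by simp
  have "\<bar>h y\<bar> \<le> \<bar>K\<bar>" for y using h(2)[of y] by linarith
  then show "AE y in lborel. norm (f y * h y) \<le> norm (f y * K)"
    by (simp add: abs_mult mult_left_mono)
qed (use prob_densityD[OF f] h in measurable)

lemma integrable_density_of_second_moment:
  assumes f: "prob_density f" and u: "u \<in> borel_measurable borel"
    and u2: "integrable lborel (\<lambda>y. f y * (u y)\<^sup>2)"
  shows "integrable lborel (\<lambda>y. f y * u y :: real)"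
proof (rule Bochner_Integration.integrable_bound)
  note fd = prob_densityD[OF f]
  show "integrable lborel (\<lambda>y. f y + f y * (u y)\<^sup>2)" using u2 fd by simp
  have "\<bar>t\<bar> \<le> 1 + t\<^sup>2" for t :: real
    using zero_le_power2[of "\<bar>t\<bar> - 1"] by (simp add: power2_diff)
  then have "f y * \<bar>u y\<bar> \<le> f y * (1 + (u y)\<^sup>2)" for y
    using fd(1) by (intro mult_left_mono) auto
  then show "AE y in lborel. norm (f y * u y) \<le> norm (f y + f y * (u y)\<^sup>2)"
    using fd(1) by (auto simp: abs_mult algebra_simps intro: order_trans[OF _ abs_ge_self])
qed (use prob_densityD(3)[OF f] u in measurable)

lemma integrable_density_times_indicator:
  assumes "prob_density f" "S \<in> sets borel"
  shows "integrable lborel (\<lambda>y. f y * indicator S y :: real)"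
  by (rule integrable_density_times_bounded[OF assms(1), where K = 1]) (use assms(2) in auto)

text \<open>The sum counts the naturals strictly below \<open>y\<close>, all of which are below
  \<open>N\<close>; hence it is the ceiling of \<open>y\<close>.\<close>

lemma sum_levels:
  fixes y :: real assumes "0 \<le> y" "y \<le> real N"
  shows "y \<le> (\<Sum>k<N. indicator {real k<..} y)" "(\<Sum>k<N. indicator {real k<..} y) \<le> y + 1"
proof -
  have "(\<Sum>k<N. indicator {real k<..} y :: real) = real (card {k \<in> {..<N}. real k < y})"
    by (simp add: indicator_def sum.If_cases Int_def)
  also have "{k \<in> {..<N}. real k < y} = {..<nat \<lceil>y\<rceil>}"
    using assms by (auto simp: less_ceiling_iff zless_nat_eq_int_zless)
  finally have e: "(\<Sum>k<N. indicator {real k<..} y :: real) = real_of_int \<lceil>y\<rceil>" using assms by simp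
  show "y \<le> (\<Sum>k<N. indicator {real k<..} y)" "(\<Sum>k<N. indicator {real k<..} y) \<le> y + 1"
    unfolding e using ceiling_correct[of y] by linarith+
qed

text \<open>A discrete layer-cake formula: \<open>h\<close> is approximated from above, up to an error
  \<open>(hi - lo) / N\<close>, by a combination of the indicators of \<open>N\<close> of its superlevel sets.\<close>

lemma quasi_concave_average_le:
  fixes h :: "real \<Rightarrow> real" and x :: "nat \<Rightarrow> real"
  assumes f: "prob_density f" and n: "0 < n" and \<eta>: "0 < \<eta>"
    and E: "\<And>I. convex I \<Longrightarrow>
        (\<Sum>i<n. indicator I (x i)) / real n \<le> (LINT y|lborel. f y * indicator I y) + \<eta>"
    and h: "h \<in> borel_measurable borel" "\<And>t. convex {y. t < h y}"
    and bd: "\<And>y. lo \<le> h y" "\<And>y. h y \<le> hi"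
  shows "(\<Sum>i<n. h (x i)) / real n \<le> (LINT y|lborel. f y * h y) + 2 * \<eta> * (hi - lo)"
proof -
  \<comment> \<open>This choice makes the discretisation error \<open>(hi - lo) / N\<close> at most
    \<open>\<eta> * (hi - lo)\<close>, which is one half of the claimed error.\<close>
  obtain N where N: "1 / \<eta> < real N" using reals_Archimedean2 by blast
  then have N0: "0 < N" using \<eta> by (cases N) auto
  define d where "d = (hi - lo) / real N"
  have d0: "0 \<le> d" using bd(1)[of 0] bd(2)[of 0] by (simp add: d_def)
  define S where "S = (\<lambda>k. {y. lo + real k * d < h y})"
  define u where "u = (\<lambda>y. lo + (\<Sum>k<N. d * indicator (S k) y))"
  have u: "h y \<le> u y \<and> u y \<le> h y + d" for y
  proof (cases "d = 0")
    \<comment> \<open>Here \<open>hi = lo\<close>, so \<open>h\<close> is constant and cannot be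
      rescaled by \<open>d\<close>.\<close>
    case True
    then show ?thesis using bd(1)[of y] bd(2)[of y] N0 by (auto simp: u_def d_def)
  next
    case False
    then have d: "0 < d" using d0 by simp
    have hi: "hi = lo + d * real N" using N0 by (simp add: d_def)
    have *: "0 \<le> (h y - lo) / d" "(h y - lo) / d \<le> real N"
      using bd[of y] d by (auto simp: hi field_simps)
    have "(\<Sum>k<N. indicator (S k) y :: real) = (\<Sum>k<N. indicator {real k<..} ((h y - lo) / d))"
      using d by (intro sum.cong) (auto simp: S_def indicator_def field_simps)
    then have "(h y - lo) / d \<le> (\<Sum>k<N. indicator (S k) y)" "(\<Sum>k<N. indicator (S k) y) \<le> (h y - lo) / d + 1"
      using sum_levels[OF *] by simp_all
    then show ?thesis using d by (auto simp: u_def sum_distrib_left[symmetric] field_simps)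
  qed
  have Sb: "S k \<in> sets borel" for k unfolding S_def by (intro convex_real_borel h(2))
  note ind = integrable_density_times_indicator[OF f Sb]
  have "\<bar>h y\<bar> \<le> \<bar>lo\<bar> + \<bar>hi\<bar>" for y using bd[of y] by linarith
  note fh = integrable_density_times_bounded[OF f h(1) this]
  have fu: "f y * u y = lo * f y + (\<Sum>k<N. d * (f y * indicator (S k) y))" for y
    by (simp only: u_def distrib_left sum_distrib_left mult_ac)
  have "(\<Sum>i<n. h (x i)) / real n \<le> (\<Sum>i<n. u (x i)) / real n"
    using u by (intro divide_right_mono sum_mono) auto
  also have "\<dots> = lo + (\<Sum>k<N. d * ((\<Sum>i<n. indicator (S k) (x i)) / real n))"
  proof -
    have "(\<Sum>i<n. \<Sum>k<N. d * indicator (S k) (x i)) = (\<Sum>k<N. \<Sum>i<n. d * indicator (S k) (x i))"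
      by (rule sum.swap)
    then have "(\<Sum>i<n. u (x i)) = real n * lo + (\<Sum>k<N. d * (\<Sum>i<n. indicator (S k) (x i)))"
      unfolding u_def sum.distrib by (simp only: sum_distrib_left) simp
    then show ?thesis using n by (simp add: add_divide_distrib sum_divide_distrib[of _ "{..<N}"])
  qed
  \<comment> \<open>Each of the \<open>N\<close> superlevel sets is convex and costs
    \<open>d * \<eta>\<close>, in total \<open>\<eta> * (hi - lo)\<close>: the other half of the
    error.\<close>
  also have "\<dots> \<le> lo + (\<Sum>k<N. d * ((LINT y|lborel. f y * indicator (S k) y) + \<eta>))"
    unfolding S_def using d0 h(2) by (intro add_left_mono sum_mono mult_left_mono E) auto
  also have "\<dots> = (LINT y|lborel. f y * u y) + \<eta> * (hi - lo)"
  proof -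
    have "(LINT y|lborel. f y * u y) = lo + (\<Sum>k<N. d * (LINT y|lborel. f y * indicator (S k) y))"
      unfolding fu using prob_densityD[OF f] ind by (simp add: Bochner_Integration.integral_add)
    moreover have "real N * (d * \<eta>) = \<eta> * (hi - lo)" using N0 by (simp add: d_def)
    ultimately show ?thesis by (simp add: distrib_left sum.distrib)
  qed
  also have "(LINT y|lborel. f y * u y) \<le> (LINT y|lborel. f y * h y + d * f y)"
  proof (rule integral_mono)
    show "integrable lborel (\<lambda>y. f y * u y)"
      unfolding fu using prob_densityD[OF f] ind
      by (intro Bochner_Integration.integrable_add Bochner_Integration.integrable_sum integrable_mult_right)
    show "integrable lborel (\<lambda>y. f y * h y + d * f y)" using prob_densityD[OF f] fh by auto
    show "f y * u y \<le> f y * h y + d * f y" for y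
      using mult_left_mono[of "u y" "h y + d" "f y"] u prob_densityD[OF f] by (simp add: algebra_simps)
  qed
  also have "\<dots> = (LINT y|lborel. f y * h y) + d"
    using prob_densityD[OF f] fh by simp
  also have "d \<le> \<eta> * (hi - lo)"
  proof -
    have "1 / real N \<le> \<eta>" using N N0 \<eta> by (simp add: field_simps)
    then have "1 / real N * (hi - lo) \<le> \<eta> * (hi - lo)"
      using bd(1)[of 0] bd(2)[of 0] by (intro mult_right_mono) auto
    then show ?thesis by (simp add: d_def)
  qed
  finally show ?thesis by simp
qed

section \<open>Finite bracketing of the intervals\<close>

lemma density_tail:
  assumes f: "prob_density f" and \<eta>: "0 < \<eta>"
  shows "\<exists>R>0. (LINT y|lborel. f y * indicator {y. R \<le> \<bar>y\<bar>} y) \<le> \<eta>"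
proof -
  note [measurable] = prob_densityD(3)[OF f]
  have "(\<lambda>m. LINT y|lborel. f y * indicator {y. real m \<le> \<bar>y\<bar>} y) \<longlonglongrightarrow> (LINT y::real|lborel. 0)"
  proof (rule integral_dominated_convergence[where w = f])
    show "AE y in lborel. (\<lambda>m. f y * indicator {y. real m \<le> \<bar>y\<bar>} y) \<longlonglongrightarrow> 0"
    proof (intro AE_I2 tendsto_eventually)
      fix y :: real
      obtain m where m: "\<bar>y\<bar> < real m" using reals_Archimedean2 by blast
      show "\<forall>\<^sub>F m in sequentially. f y * indicator {y. real m \<le> \<bar>y\<bar>} y = 0"
        using eventually_ge_at_top[of m] by eventually_elim (use m in auto)
    qed
  qed (use prob_densityD[OF f] in \<open>auto simp: indicator_def\<close>)
  then have "\<forall>\<^sub>F m in sequentially. (LINT y|lborel. f y * indicator {y. real m \<le> \<bar>y\<bar>} y) < \<eta>"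
    using order_tendstoD(2)[of _ 0 sequentially \<eta>] \<eta> by simp
  then have "\<forall>\<^sub>F m in sequentially. (LINT y|lborel. f y * indicator {y. real m \<le> \<bar>y\<bar>} y) < \<eta> \<and> 0 < m"
    using eventually_gt_at_top by (rule eventually_conj)
  then obtain m where "(LINT y|lborel. f y * indicator {y. real m \<le> \<bar>y\<bar>} y) < \<eta>" "0 < m"
    using eventually_happens by fastforce
  then show ?thesis by (intro exI[of _ "real m"]) auto
qed

lemma density_interval_le:
  assumes f: "prob_density f" and B: "\<And>y. f y \<le> B" and "a \<le> b"
  shows "(LINT y|lborel. f y * indicator {a..b} y) \<le> B * (b - a)"
proof -
  have "(LINT y|lborel. f y * indicator {a..b} y) \<le> (LINT y|lborel. B * indicator {a..b} y)"
  proof (intro integral_mono)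
    show "integrable lborel (\<lambda>y. f y * indicator {a..b} y)"
      by (intro integrable_density_times_indicator f) auto
  qed (use B in \<open>auto intro!: mult_right_mono integrable_mult_right integrable_real_indicator emeasure_bounded_finite\<close>)
  then show ?thesis using assms by simp
qed

text \<open>The brackets are unions of consecutive level sets of the truncated and rescaled floor
  function \<open>c\<close>. Since \<open>c\<close> is monotone, a convex set and its bracket differ only inside the two
  extreme levels.\<close>

lemma finite_bracketing_of_convex_sets:
  assumes f: "prob_density f" and B: "0 < B" "\<And>y. f y \<le> B" and \<eta>: "0 < \<eta>"
  obtains \<J> :: "real set set" where "finite \<J>" "\<J> \<subseteq> sets borel"
    "\<And>I. convex I \<Longrightarrow> \<exists>J\<in>\<J>. I \<subseteq> J \<and>
       (LINT y|lborel. f y * indicator J y) \<le> (LINT y|lborel. f y * indicator I y) + \<eta>"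
proof -
  obtain R where R: "0 < R" "(LINT y|lborel. f y * indicator {y. R \<le> \<bar>y\<bar>} y) \<le> \<eta> / 4"
    using density_tail[OF f, of "\<eta> / 4"] \<eta> by auto
  \<comment> \<open>An interval of length \<open>h\<close> has mass at most
    \<open>\<eta> / 4\<close>; together with the tail beyond \<open>R\<close> every level set of
    \<open>c\<close> has mass at most \<open>\<eta> / 2\<close>.\<close>
  define h where "h = \<eta> / (4 * B)"
  have h: "0 < h" using B \<eta> by (simp add: h_def)
  obtain k where k: "R / h < real k" using reals_Archimedean2 by blast
  \<comment> \<open>The extra 1 makes up for rounding down: a floor of at most \<open>- K\<close>
    only yields \<open>y < - k * h\<close>, which still lies in the tail since
    \<open>R < k * h\<close>.\<close>
  define K where "K = int k + 1"
  define c where "c = (\<lambda>x. max (- K) (min K \<lfloor>x / h\<rfloor>))"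
  have mono: "c x \<le> c y" if "x \<le> y" for x y
  proof -
    have "\<lfloor>x / h\<rfloor> \<le> \<lfloor>y / h\<rfloor>" using that h by (intro floor_mono divide_right_mono) auto
    then show ?thesis by (auto simp: c_def)
  qed
  have range: "c x \<in> {-K..K}" for x by (auto simp: c_def K_def)
  define J where "J = (\<lambda>(i, j). {x. i \<le> c x \<and> c x \<le> j})"
  have Jb: "J p \<in> sets borel" for p
    unfolding J_def by (rule convex_real_borel)
      (auto simp: is_interval_convex_1[symmetric] is_interval_1 split: prod.split intro: order_trans[OF _ mono] order_trans[OF mono])
  have cell: "(LINT y|lborel. f y * indicator (J (i, i)) y) \<le> \<eta> / 2" for i
  proof -
    let ?A = "{of_int i * h..of_int i * h + h}" and ?T = "{y. R \<le> \<bar>y\<bar>}"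
    have sub: "y \<in> ?A \<or> y \<in> ?T" if "c y = i" for y
    proof -
      have fl: "of_int \<lfloor>y / h\<rfloor> * h \<le> y" "y < (of_int \<lfloor>y / h\<rfloor> + 1) * h"
        using h floor_divide_lower[OF h, of y] floor_divide_upper[OF h, of y] by auto
      have Rk: "R < real k * h" using k h by (simp add: field_simps)
      have "\<lfloor>y / h\<rfloor> = i \<or> \<lfloor>y / h\<rfloor> \<ge> K \<or> \<lfloor>y / h\<rfloor> \<le> - K"
        using that by (auto simp: c_def max_def min_def split: if_splits)
      then consider "\<lfloor>y / h\<rfloor> = i" | "\<lfloor>y / h\<rfloor> \<ge> K" | "\<lfloor>y / h\<rfloor> \<le> - K"
        by blast
      then show ?thesis
      proof cases
        case 1
        then show ?thesis using fl by (auto simp: algebra_simps)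
      next
        case 2
        then have "real k * h \<le> of_int \<lfloor>y / h\<rfloor> * h" using h by (intro mult_right_mono) (auto simp: K_def)
        then show ?thesis using fl Rk by auto
      next
        case 3
        then have "(of_int \<lfloor>y / h\<rfloor> + 1) * h \<le> - real k * h" using h by (intro mult_right_mono) (auto simp: K_def)
        then show ?thesis using fl Rk by auto
      qed
    qed
    have "(LINT y|lborel. f y * indicator (J (i, i)) y)
      \<le> (LINT y|lborel. f y * indicator ?A y + f y * indicator ?T y)"
      using sub prob_densityD(1)[OF f]
      by (intro integral_mono Bochner_Integration.integrable_add integrable_density_times_indicator f Jb)
         (force simp: J_def indicator_def)+
    also have "\<dots> = (LINT y|lborel. f y * indicator ?A y) + (LINT y|lborel. f y * indicator ?T y)"
      by (intro Bochner_Integration.integral_add integrable_density_times_indicator f) auto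
    also have "\<dots> \<le> B * (of_int i * h + h - of_int i * h) + \<eta> / 4"
      using h by (intro add_mono R density_interval_le f B) auto
    also have "\<dots> = \<eta> / 2" using B by (simp add: h_def)
    finally show ?thesis .
  qed
  have br: "\<exists>P \<in> J ` ({-K..K} \<times> {-K..K}). I \<subseteq> P \<and>
       (LINT y|lborel. f y * indicator P y) \<le> (LINT y|lborel. f y * indicator I y) + \<eta>"
    if I: "convex I" for I
  proof (cases "I = {}")
    case True
    have "(-K, -K) \<in> {-K..K} \<times> {-K..K}" by (auto simp: K_def)
    then show ?thesis using True cell[of "-K"] \<eta> by (intro bexI[of _ "J (-K, -K)"]) auto
  next
    case False
    have fin: "finite (c ` I)" by (rule finite_subset[of _ "{-K..K}"]) (use range in auto)
    define i where "i = Min (c ` I)"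
    define j where "j = Max (c ` I)"
    have "i \<in> c ` I" "j \<in> c ` I" using fin False by (auto simp: i_def j_def)
    then obtain y z where yz: "y \<in> I" "c y = i" "z \<in> I" "c z = j" by auto
    have sub: "I \<subseteq> J (i, j)" using fin by (auto simp: J_def i_def j_def)
    \<comment> \<open>A point in a level strictly between the extreme ones lies between
      \<open>y\<close> and \<open>z\<close> by monotonicity of \<open>c\<close>, hence in
      \<open>I\<close> by convexity.\<close>
    have cover: "w \<in> I \<or> c w = i \<or> c w = j" if "w \<in> J (i, j)" for w
    proof (rule ccontr)
      assume *: "\<not> ?thesis"
      then have "i < c w" "c w < j" using that by (auto simp: J_def)
      then have "y < w" "w < z" using mono[of w y] mono[of z w] yz by (auto simp: not_le[symmetric])
      then have "w \<in> I" using I yz unfolding is_interval_convex_1[symmetric] is_interval_1 by (meson less_imp_le)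
      then show False using * by simp
    qed
    note int = integrable_density_times_indicator[OF f]
    have "(LINT w|lborel. f w * indicator (J (i, j)) w)
      \<le> (LINT w|lborel. f w * indicator I w + (f w * indicator (J (i, i)) w + f w * indicator (J (j, j)) w))"
    proof (intro integral_mono Bochner_Integration.integrable_add int Jb convex_real_borel I)
      fix w
      show "f w * indicator (J (i, j)) w
         \<le> f w * indicator I w + (f w * indicator (J (i, i)) w + f w * indicator (J (j, j)) w)"
        using cover[of w] prob_densityD(1)[OF f, of w] by (force simp: indicator_def J_def)
    qed
    also have "\<dots> = (LINT w|lborel. f w * indicator I w) +
        ((LINT w|lborel. f w * indicator (J (i, i)) w) + (LINT w|lborel. f w * indicator (J (j, j)) w))"
      using int[OF Jb] int[OF convex_real_borel[OF I]] by simp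
    also have "\<dots> \<le> (LINT w|lborel. f w * indicator I w) + (\<eta> / 2 + \<eta> / 2)"
      by (intro add_left_mono add_mono cell)
    finally show ?thesis using sub yz range[of y] range[of z] by (intro bexI[of _ "J (i, j)"]) auto
  qed
  show ?thesis
    by (rule that[of "J ` ({-K..K} \<times> {-K..K})"]) (use Jb br in auto)
qed

subsection \<open>Stability of the maximum likelihood estimator\<close>

text \<open>All claims follow from the bound \<open>a * exp (- b * \<bar>y\<bar>)\<close>: square
  roots decay at rate \<open>b / 2\<close>, and on \<open>[0, a]\<close> the function
  \<open>t * (ln t)\<^sup>2\<close> is dominated by a multiple of \<open>sqrt t\<close>. The second
  moment of \<open>ln f\<close> is what Chebyshev's inequality needs.\<close>

lemma log_concave_density_bounds:
  assumes f: "log_concave f" "prob_density f"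
  obtains B where "0 < B" "\<And>y. f y \<le> B"
    and "integrable lborel (\<lambda>y. sqrt (f y))"
    and "integrable lborel (\<lambda>y. f y * (ln (f y))\<^sup>2)"
    and "integrable lborel (\<lambda>y. f y * ln (f y))"
proof -
  note fd = prob_densityD[OF f(2)]
  note [measurable] = fd(3)
  obtain a b where ab: "0 < a" "0 < b" "\<And>y. f y \<le> a * exp (- b * \<bar>y\<bar>)"
    using log_concave_exp_bound[OF f(1) fd(2)] fd(4) by auto
  have bound: "f y \<le> a" for y
  proof -
    have "exp (- b * \<bar>y\<bar>) \<le> 1" using ab by simp
    then have "a * exp (- b * \<bar>y\<bar>) \<le> a" using ab(1) by simp
    then show ?thesis using ab(3)[of y] by linarith
  qed
  have sqrt: "integrable lborel (\<lambda>y. sqrt (f y))"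
  proof (rule Bochner_Integration.integrable_bound)
    show "integrable lborel (\<lambda>y. sqrt a * exp (- (b / 2) * \<bar>y\<bar>))"
      using ab by (intro integrable_mult_right integrable_exp_neg_abs) auto
    have "sqrt (f y) \<le> sqrt a * exp (- (b / 2) * \<bar>y\<bar>)" for y
    proof -
      have "exp (- b * \<bar>y\<bar>) = (exp (- (b / 2) * \<bar>y\<bar>))\<^sup>2" by (simp add: power2_eq_square exp_add[symmetric])
      then have "sqrt (a * exp (- b * \<bar>y\<bar>)) = sqrt a * exp (- (b / 2) * \<bar>y\<bar>)"
        by (simp add: real_sqrt_mult)
      then show ?thesis using ab(3)[of y] by (metis real_sqrt_le_mono)
    qed
    then show "AE y in lborel. norm (sqrt (f y)) \<le> norm (sqrt a * exp (- (b / 2) * \<bar>y\<bar>))"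
      using ab fd(1) by auto
  qed measurable
  have sq_ln: "t * (ln t)\<^sup>2 \<le> 16 * (1 + a) * sqrt t" if t: "0 \<le> t" "t \<le> a" for t
  proof (cases "t = 0")
    case False
    \<comment> \<open>With \<open>t = s ^ 4\<close> the claim reduces to bounding
      \<open>s\<^sup>2 * (ln s)\<^sup>2\<close>: by \<open>t\<close> via \<open>ln s \<le> s\<close>
      if \<open>s \<ge> 1\<close>, and by 1 via \<open>- ln s \<le> 1 / s\<close> otherwise.\<close>
    define s where "s = sqrt (sqrt t)"
    have s0: "0 < s" and st: "sqrt t = s\<^sup>2" using t False by (auto simp: s_def)
    have "(s\<^sup>2)\<^sup>2 = t" using t by (simp flip: st)
    then have s: "0 < s" "t = s ^ 4" using s0 by simp_all
    have lt: "ln t = 4 * ln s" using s by (simp add: ln_realpow)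
    have 1: "ln s \<le> s" using s ln_le_minus_one[of s] by linarith
    have 2: "- ln s \<le> 1 / s" using s ln_le_minus_one[of "1 / s"] by (simp add: ln_div)
    have "s\<^sup>2 * (ln s)\<^sup>2 \<le> 1 + a"
    proof (cases "ln s \<ge> 0")
      case True
      have "s\<^sup>2 * (ln s)\<^sup>2 \<le> s\<^sup>2 * s\<^sup>2" using 1 True s by (intro mult_left_mono power_mono) auto
      also have "\<dots> = t" by (simp add: s(2) flip: power_add)
      finally show ?thesis using t by simp
    next
      case False
      have "(ln s)\<^sup>2 \<le> (1 / s)\<^sup>2" using 2 False s by (subst power2_minus[symmetric], intro power_mono) auto
      then have "s\<^sup>2 * (ln s)\<^sup>2 \<le> s\<^sup>2 * (1 / s)\<^sup>2" by (intro mult_left_mono) auto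
      then show ?thesis using s ab by (simp add: power_divide)
    qed
    then have "s\<^sup>2 * (s\<^sup>2 * (ln s)\<^sup>2) \<le> s\<^sup>2 * (1 + a)" by (intro mult_left_mono) auto
    then show ?thesis unfolding st lt unfolding s(2) by (simp add: power2_eq_square power4_eq_xxxx algebra_simps)
  qed simp
  have ln2: "integrable lborel (\<lambda>y. f y * (ln (f y))\<^sup>2)"
  proof (rule Bochner_Integration.integrable_bound)
    show "integrable lborel (\<lambda>y. 16 * (1 + a) * sqrt (f y))" using sqrt by simp
    show "AE y in lborel. norm (f y * (ln (f y))\<^sup>2) \<le> norm (16 * (1 + a) * sqrt (f y))"
      using sq_ln fd(1) bound ab(1) by (auto simp: abs_mult)
  qed measurable
  have "integrable lborel (\<lambda>y. f y * ln (f y))"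
    by (rule integrable_density_of_second_moment[OF f(2) _ ln2]) measurable
  then show ?thesis using that[OF ab(1) bound sqrt ln2] by blast
qed

text \<open>At the fraction \<open>1 / (4 * l)\<close> of the way from \<open>m\<close> to
  \<open>z\<close> the log-density has dropped by at most 1, as the whole drop is at most
  \<open>4 * l\<close>. So \<open>g\<close> is at least \<open>exp (l - 1)\<close> on that piece,
  and unit mass bounds its length. The point \<open>m\<close> need not be a maximum.\<close>

lemma log_concave_level_width:
  assumes g: "log_concave g" "prob_density g"
    and l: "1 / 4 \<le> l" and m: "0 < g m" "ln (g m) = l" and z: "0 < g z" "- 3 * l \<le> ln (g z)"
  shows "\<bar>z - m\<bar> \<le> 4 * l * exp (1 - l)"
proof -
  define t where "t = 1 / (4 * l)"
  define u where "u = m + t * (z - m)"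
  have t: "0 \<le> t" "t \<le> 1" using l by (auto simp: t_def)
  have e: "(1 - t) * m + t * z = u" by (simp add: u_def algebra_simps)
  note D = log_concaveD[OF g(1) m(1) z(1) t, unfolded e m(2)]
  have "l - 1 = (1 - t) * l + t * (- 3 * l)" using l by (simp add: t_def field_simps)
  also have "\<dots> \<le> (1 - t) * l + t * ln (g z)" using t z by (intro add_left_mono mult_left_mono) auto
  also note D(2)
  finally have u: "exp (l - 1) \<le> g u" using D(1) by (simp add: ln_ge_iff)
  have m': "exp (l - 1) \<le> g m" using m by (simp add: ln_ge_iff[symmetric])
  let ?I = "{min m u..max m u}"
  have "(LINT y|lborel. exp (l - 1) * indicator ?I y) \<le> integral\<^sup>L lborel g"
  proof (rule integral_mono)
    show "integrable lborel (\<lambda>y. exp (l - 1) * indicator ?I y)"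
      by (intro integrable_mult_right integrable_real_indicator emeasure_bounded_finite) auto
    show "exp (l - 1) * indicator ?I y \<le> g y" for y
    proof (cases "y \<in> ?I")
      case True
      then have "min (g (min m u)) (g (max m u)) \<le> g y" by (intro log_concave_ge_min[OF g(1)]) auto
      then show ?thesis using True u m' by (auto simp: min_def max_def split: if_splits)
    qed (use prob_densityD(1)[OF g(2)] in auto)
  qed (rule prob_densityD[OF g(2)])
  then have "exp (l - 1) * \<bar>u - m\<bar> \<le> 1"
    using prob_densityD(4)[OF g(2)] by (simp add: min_def max_def abs_if split: if_splits)
  then have "exp (l - 1) * (t * \<bar>z - m\<bar>) \<le> 1" using t by (simp add: u_def abs_mult)
  then have "\<bar>z - m\<bar> * exp (l - 1) \<le> 4 * l" using l by (simp add: t_def field_simps)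
  then show ?thesis by (simp add: exp_diff field_simps)
qed

text \<open>If \<open>g\<close> had a huge maximum \<open>exp l\<close>, then \<open>g \<ge> exp (- 3 * l)\<close> only on a short
  interval, which contains at most half of the sample, so the log-likelihood of \<open>g\<close> would be about
  \<open>- l\<close> or less.\<close>

lemma log_concave_estimator_bounded:
  assumes f: "prob_density f" and B: "0 < B" "\<And>y. f y \<le> B"
  shows "\<exists>C\<ge>1. \<forall>n x g. 0 < n \<longrightarrow> log_concave g \<longrightarrow> prob_density g \<longrightarrow> (\<forall>i<n. 0 < g (x i)) \<longrightarrow>
     c \<le> (\<Sum>i<n. ln (g (x i))) / real n \<longrightarrow>
     (\<forall>I. convex I \<longrightarrow>
        (\<Sum>i<n. indicator I (x i)) / real n \<le> (LINT y|lborel. f y * indicator I y) + 1 / 4) \<longrightarrow>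
     (\<forall>y. g y \<le> C)"
proof -
  \<comment> \<open>The term with \<open>B\<close> makes the critical interval have mass at most 1/4
    under \<open>f\<close>; the term with \<open>c\<close> makes the resulting likelihood bound
    \<open>1 / 2 - l\<close> smaller than \<open>c\<close>.\<close>
  define L where "L = 1 + 64 * exp 1 * B + \<bar>c\<bar>"
  have L: "1 \<le> L" using B by (simp add: L_def)
  have bd: "g y \<le> exp (L + 1)"
    if n: "0 < n" and g: "log_concave g" "prob_density g" and pos: "\<And>i. i < n \<Longrightarrow> 0 < g (x i)"
      and av: "c \<le> (\<Sum>i<n. ln (g (x i))) / real n"
      and E: "\<And>I. convex I \<Longrightarrow>
        (\<Sum>i<n. indicator I (x i)) / real n \<le> (LINT y|lborel. f y * indicator I y) + 1 / 4"
    for n x g y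
  proof (rule ccontr)
    assume y: "\<not> ?thesis"
    define S where "S = (SUP y. g y)"
    obtain a where "\<And>y. g y \<le> a" using log_concave_density_bounds[OF g] by metis
    then have bdd: "bdd_above (range g)" by (auto simp: bdd_above_def)
    then have S: "g z \<le> S" for z by (auto simp: S_def intro: cSUP_upper)
    have "exp (L + 1) < S" using y S[of y] by linarith
    then have "S / exp 1 < S" using order.strict_trans[OF exp_gt_zero] by (auto simp: field_simps)
    \<comment> \<open>A point within a factor \<open>exp 1\<close> of the supremum avoids showing
      that it is attained; the price is \<open>ln g \<le> l + 1\<close> instead of
      \<open>l\<close>.\<close>
    then obtain m where m: "S / exp 1 < g m" using less_cSUP_iff[OF _ bdd] by (auto simp: S_def)
    have "exp 1 * exp L < S" using \<open>exp (L + 1) < S\<close> by (simp add: exp_add mult.commute)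
    also have "S < exp 1 * g m" using m by (simp add: field_simps)
    finally have gm: "exp L < g m" by simp
    then have gm0: "0 < g m" using order.strict_trans[OF exp_gt_zero] by blast
    define l where "l = ln (g m)"
    have l: "L < l" using gm gm0 unfolding l_def by (metis exp_less_cancel_iff exp_ln)
    have up: "ln (g z) \<le> l + 1" if "0 < g z" for z
    proof -
      have "g z \<le> exp 1 * g m" using S[of z] m by (simp add: field_simps)
      then have "ln (g z) \<le> ln (exp 1 * g m)" using that by simp
      then show ?thesis using gm0 by (simp add: ln_mult l_def)
    qed
    define r where "r = 4 * l * exp (1 - l)"
    have r: "0 \<le> r" "B * (2 * r) \<le> 1 / 4"
    proof -
      have "l\<^sup>2 / 2 \<le> exp l" using exp_lower_Taylor_quadratic[of l] l L by linarith
      have "64 * exp 1 * B \<le> l" using l by (simp add: L_def)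
      then have "64 * exp 1 * B * l \<le> l * l" using l L by (intro mult_right_mono) auto
      also have "\<dots> \<le> 2 * exp l" using \<open>l\<^sup>2 / 2 \<le> exp l\<close> by (simp add: power2_eq_square)
      finally show "B * (2 * r) \<le> 1 / 4" by (simp add: r_def exp_diff field_simps)
    qed (use l L in \<open>simp add: r_def\<close>)
    let ?I = "{m - r..m + r}"
    \<comment> \<open>The right-hand side is \<open>l + 1\<close> on the interval and
      \<open>- 3 * l\<close> off it.\<close>
    have "ln (g (x i)) \<le> - 3 * l + (4 * l + 1) * indicator ?I (x i)" if "i < n" for i
    proof (cases "- 3 * l \<le> ln (g (x i))")
      case True
      have "\<bar>x i - m\<bar> \<le> r" unfolding r_def
        using l L gm0 pos[OF that] True by (intro log_concave_level_width[OF g]) (auto simp: l_def)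
      then have "x i \<in> ?I" by auto
      then show ?thesis using up[OF pos[OF that]] by simp
    next
      case False
      then show ?thesis using l L by (simp add: indicator_def)
    qed
    then have "(\<Sum>i<n. ln (g (x i))) \<le> (\<Sum>i<n. - 3 * l + (4 * l + 1) * indicator ?I (x i))"
      by (intro sum_mono) auto
    then have "(\<Sum>i<n. ln (g (x i))) / real n
       \<le> (\<Sum>i<n. - 3 * l + (4 * l + 1) * indicator ?I (x i)) / real n"
      by (rule divide_right_mono) simp
    also have "\<dots> = - 3 * l + (4 * l + 1) * ((\<Sum>i<n. indicator ?I (x i)) / real n)"
    proof -
      have "(\<Sum>i<n. - 3 * l + (4 * l + 1) * indicator ?I (x i))
          = real n * (- 3 * l) + (4 * l + 1) * (\<Sum>i<n. indicator ?I (x i))"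
        unfolding sum.distrib sum_distrib_left by simp
      then show ?thesis using n by (simp add: add_divide_distrib diff_divide_distrib)
    qed
    \<comment> \<open>The 1/2 consists of the mass 1/4 under \<open>f\<close> and the permitted
      empirical excess 1/4.\<close>
    also have "\<dots> \<le> - 3 * l + (4 * l + 1) * (1 / 2)"
    proof -
      have "(\<Sum>i<n. indicator ?I (x i)) / real n \<le> B * (m + r - (m - r)) + 1 / 4"
        using E[of ?I] density_interval_le[OF f B(2), of "m - r" "m + r"] r by auto
      then have "(\<Sum>i<n. indicator ?I (x i)) / real n \<le> 1 / 2" using r by simp
      then show ?thesis using l L by (intro add_left_mono mult_left_mono) auto
    qed
    finally have "c \<le> - 3 * l + (4 * l + 1) * (1 / 2)" by (rule order_trans[OF av])
    also have "\<dots> = 1 / 2 - l" by (simp add: algebra_simps)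
    finally have "c \<le> 1 / 2 - l" .
    moreover have "0 < 64 * exp 1 * B" using B by simp
    ultimately show False using l abs_ge_minus_self[of c] unfolding L_def by linarith
  qed
  show ?thesis
  proof (intro exI[of _ "exp (L + 1)"] conjI allI impI)
    show "1 \<le> exp (L + 1)" using L by simp
    fix n x g y
    assume "0 < n" "log_concave g" "prob_density g" "\<forall>i<n. 0 < g (x i)"
      "c \<le> (\<Sum>i<n. ln (g (x i))) / real n"
      "\<forall>I. convex I \<longrightarrow>
        (\<Sum>i<n. indicator I (x i)) / real n \<le> (LINT y|lborel. f y * indicator I y) + 1 / 4"
    then show "g y \<le> exp (L + 1)" by (intro bd[of n g x]) auto
  qed
qed

section \<open>Hellinger distance, log-ratio and L1 distance\<close>

lemma abs_diff_le_hellinger: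
  fixes a b \<kappa> :: real
  assumes "0 \<le> a" "0 \<le> b" "0 < \<kappa>"
  shows "\<bar>a - b\<bar> \<le> (sqrt a - sqrt b)\<^sup>2 / (2 * \<kappa>) + \<kappa> * (a + b)"
proof -
  define p where "p = \<bar>sqrt a - sqrt b\<bar>"
  define q where "q = sqrt a + sqrt b"
  have "\<bar>a - b\<bar> = p * q"
  proof -
    have "a - b = (sqrt a - sqrt b) * q" using assms by (simp add: q_def algebra_simps)
    then show ?thesis using assms by (simp add: p_def q_def abs_mult)
  qed
  \<comment> \<open>A weighted arithmetic-geometric mean inequality replaces Cauchy-Schwarz, so that
    the bound can be integrated termwise; the weight \<open>\<kappa>\<close> is chosen
    later.\<close>
  moreover have "p * q \<le> p\<^sup>2 / (2 * \<kappa>) + \<kappa> * (q\<^sup>2 / 2)"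
  proof -
    have "0 \<le> (p - \<kappa> * q)\<^sup>2" by simp
    then have "2 * \<kappa> * (p * q) \<le> p\<^sup>2 + \<kappa> * \<kappa> * q\<^sup>2" by (simp add: power2_eq_square algebra_simps)
    then show ?thesis using assms(3) by (simp add: field_simps)
  qed
  moreover have "q\<^sup>2 / 2 \<le> a + b"
  proof -
    have "0 \<le> (sqrt a - sqrt b)\<^sup>2" by simp
    then show ?thesis using assms by (simp add: q_def power2_sum power2_diff)
  qed
  then have "\<kappa> * (q\<^sup>2 / 2) \<le> \<kappa> * (a + b)" using assms by (intro mult_left_mono) auto
  ultimately show ?thesis by (simp add: p_def)
qed

text \<open>Apply \<open>ln z \<le> z - 1\<close> to the square root of
  \<open>(b + \<epsilon>) / a\<close> and split off \<open>sqrt \<epsilon>\<close> by subadditivity.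
  For densities the terms \<open>- a + b\<close> integrate to 0. At \<open>a = 0\<close> both sides
  equal \<open>b\<close>.\<close>

lemma hellinger_le_log_ratio:
  fixes a b \<epsilon> :: real
  assumes "0 \<le> a" "0 \<le> b" "0 < \<epsilon>"
  shows "(sqrt a - sqrt b)\<^sup>2 \<le> a * ln a - a * ln (b + \<epsilon>) - a + b + 2 * sqrt \<epsilon> * sqrt a"
proof (cases "a = 0")
  case False
  define p where "p = sqrt a"
  define q where "q = sqrt (b + \<epsilon>)"
  have p: "0 < p" "p\<^sup>2 = a" using assms False by (auto simp: p_def)
  have q: "0 < q" "q\<^sup>2 = b + \<epsilon>" using assms by (auto simp: q_def)
  have "ln (q / p) \<le> q / p - 1" using p q by (intro ln_le_minus_one) auto
  moreover have "ln a = 2 * ln p" "ln (b + \<epsilon>) = 2 * ln q"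
    using p q by (metis ln_realpow of_nat_numeral)+
  ultimately have "ln (b + \<epsilon>) - ln a \<le> 2 * (q / p - 1)" using p q by (simp add: ln_div)
  then have "p\<^sup>2 * (ln (b + \<epsilon>) - ln a) \<le> p\<^sup>2 * (2 * (q / p - 1))" by (intro mult_left_mono) auto
  also have "\<dots> = 2 * (p * q) - 2 * a" using p by (simp add: field_simps power2_eq_square)
  finally have 1: "a * ln (b + \<epsilon>) - a * ln a \<le> 2 * (p * q) - 2 * a"
    using p by (simp add: algebra_simps)
  have "q \<le> sqrt b + sqrt \<epsilon>" using assms sqrt_add_le_add_sqrt[of b \<epsilon>] by (simp add: q_def)
  then have "p * q \<le> p * (sqrt b + sqrt \<epsilon>)" using p by (intro mult_left_mono) auto
  then show ?thesis using 1 assms by (simp add: p_def power2_diff algebra_simps)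
qed (use assms in simp)

text \<open>The offset \<open>\<epsilon>\<close> keeps the logarithm bounded where \<open>g\<close>
  is small or zero. Its own contribution does not involve \<open>\<eta>\<close>, so
  \<open>\<epsilon>\<close> can be fixed first and \<open>\<eta>\<close> then made small against the
  logarithmic factor.\<close>

lemma hellinger_log_concave_estimator:
  assumes f: "prob_density f" "integrable lborel (\<lambda>y. sqrt (f y))" "integrable lborel (\<lambda>y. f y * ln (f y))"
    and g: "log_concave g" "prob_density g" "\<And>y. g y \<le> C" and C: "1 \<le> C"
    and \<epsilon>: "0 < \<epsilon>" "\<epsilon> \<le> 1" and n: "0 < n" and \<eta>: "0 < \<eta>"
    and pos: "\<And>i. i < n \<Longrightarrow> 0 < g (x i)"
    and lik: "(LINT y|lborel. f y * ln (f y)) - \<eta> \<le> (\<Sum>i<n. ln (g (x i))) / real n"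
    and E: "\<And>I. convex I \<Longrightarrow>
        (\<Sum>i<n. indicator I (x i)) / real n \<le> (LINT y|lborel. f y * indicator I y) + \<eta>"
  shows "integrable lborel (\<lambda>y. (sqrt (f y) - sqrt (g y))\<^sup>2)"
    and "(LINT y|lborel. (sqrt (f y) - sqrt (g y))\<^sup>2)
      \<le> \<eta> * (1 + 2 * ln ((C + 1) / \<epsilon>)) + 2 * sqrt \<epsilon> * (LINT y|lborel. sqrt (f y))"
proof -
  note fd = prob_densityD[OF f(1)] and gd = prob_densityD[OF g(2)]
  note [measurable] = fd(3) gd(3)
  define h where "h = (\<lambda>y. ln (g y + \<epsilon>))"
  have gpos: "0 < g y + \<epsilon>" for y using gd(1)[of y] \<epsilon> by linarith
  have hm: "h \<in> borel_measurable borel" unfolding h_def by measurable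
  have hb: "ln \<epsilon> \<le> h y" "h y \<le> ln (C + 1)" for y
    using gd(1)[of y] g(3)[of y] \<epsilon> by (auto simp: h_def)
  \<comment> \<open>The superlevel sets of \<open>h\<close> are superlevel sets of
    \<open>g\<close>.\<close>
  have hc: "convex {y. t < h y}" for t
  proof -
    have "t < ln z \<longleftrightarrow> exp t < z" if "0 < z" for z :: real
      using that by (metis exp_less_cancel_iff exp_ln)
    then have "t < h y \<longleftrightarrow> exp t - \<epsilon> < g y" for y using gpos[of y] by (auto simp: h_def)
    then show ?thesis using convex_superlevel_log_concave[OF g(1)] by simp
  qed
  have "\<bar>h y\<bar> \<le> \<bar>ln \<epsilon>\<bar> + \<bar>ln (C + 1)\<bar>" for y using hb[of y] by linarith
  note fh = integrable_density_times_bounded[OF f(1) hm this]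
  show int: "integrable lborel (\<lambda>y. (sqrt (f y) - sqrt (g y))\<^sup>2)"
  proof (rule Bochner_Integration.integrable_bound)
    show "integrable lborel (\<lambda>y. f y + g y)" using fd gd by simp
    have "(sqrt (f y) - sqrt (g y))\<^sup>2 \<le> f y + g y" for y
      using fd(1)[of y] gd(1)[of y] by (simp add: power2_diff)
    then show "AE y in lborel. norm ((sqrt (f y) - sqrt (g y))\<^sup>2) \<le> norm (f y + g y)"
      using fd(1) gd(1) by auto
  qed measurable
  have "ln (g (x i)) \<le> h (x i)" if "i < n" for i using pos[OF that] \<epsilon> by (simp add: h_def)
  then have "(\<Sum>i<n. ln (g (x i))) / real n \<le> (\<Sum>i<n. h (x i)) / real n"
    by (intro divide_right_mono sum_mono) auto
  also have "\<dots> \<le> (LINT y|lborel. f y * h y) + 2 * \<eta> * (ln (C + 1) - ln \<epsilon>)"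
    by (rule quasi_concave_average_le[OF f(1) n \<eta> E hm hc hb])
  also have "ln (C + 1) - ln \<epsilon> = ln ((C + 1) / \<epsilon>)" using C \<epsilon> by (simp add: ln_div)
  finally have main: "(LINT y|lborel. f y * ln (f y)) - (LINT y|lborel. f y * h y)
      \<le> \<eta> * (1 + 2 * ln ((C + 1) / \<epsilon>))"
    using lik by (simp add: algebra_simps)
  have "(LINT y|lborel. (sqrt (f y) - sqrt (g y))\<^sup>2)
     \<le> (LINT y|lborel. f y * ln (f y) - f y * h y - f y + g y + 2 * sqrt \<epsilon> * sqrt (f y))"
    unfolding h_def using fd gd f fh[unfolded h_def]
    by (intro integral_mono int hellinger_le_log_ratio \<epsilon>) auto
  also have "\<dots> = (LINT y|lborel. f y * ln (f y)) - (LINT y|lborel. f y * h y) + 2 * sqrt \<epsilon> * (LINT y|lborel. sqrt (f y))"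
    using fd gd f fh by simp
  finally show "(LINT y|lborel. (sqrt (f y) - sqrt (g y))\<^sup>2)
      \<le> \<eta> * (1 + 2 * ln ((C + 1) / \<epsilon>)) + 2 * sqrt \<epsilon> * (LINT y|lborel. sqrt (f y))"
    using main by linarith
qed

text \<open>The deterministic core: for given \<open>f\<close> and \<open>\<tau>\<close>, finitely
  many sample averages, those of \<open>ln f\<close> and of the indicators of the brackets, decide
  whether the estimator is close to \<open>f\<close>. A law of large numbers for finitely many
  functions therefore suffices.\<close>

lemma log_concave_mle_L1_stability:
  assumes f: "log_concave f" "prob_density f" and \<tau>: "0 < \<tau>"
  obtains \<J> :: "real set set" and \<eta> :: real where "finite \<J>" "\<J> \<subseteq> sets borel" "0 < \<eta>"
    "\<And>n x \<phi>. \<lbrakk>0 < n; is_log_concave_mle n x \<phi>; \<And>i. i < n \<Longrightarrow> 0 < f (x i);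
       \<And>J. J \<in> \<J> \<Longrightarrow> (\<Sum>i<n. indicator J (x i)) / real n \<le> (LINT y|lborel. f y * indicator J y) + \<eta>;
       (LINT y|lborel. f y * ln (f y)) - \<eta> \<le> (\<Sum>i<n. ln (f (x i))) / real n\<rbrakk>
     \<Longrightarrow> prob_density (\<lambda>y. exp_ext (\<phi> y)) \<and> (LINT y|lborel. \<bar>exp_ext (\<phi> y) - f y\<bar>) \<le> \<tau>"
proof -
  obtain B where B: "0 < B" "\<And>y. f y \<le> B"
    and f_int: "integrable lborel (\<lambda>y. sqrt (f y))" "integrable lborel (\<lambda>y. f y * ln (f y))"
    using log_concave_density_bounds[OF f] by blast
  define H where "H = (LINT y|lborel. f y * ln (f y))"
  define Q where "Q = (LINT y|lborel. sqrt (f y))"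
  have Q: "0 \<le> Q" using prob_densityD(1)[OF f(2)] by (simp add: Q_def integral_nonneg)
  obtain C where C: "1 \<le> C" "\<forall>n x g. 0 < n \<longrightarrow> log_concave g \<longrightarrow> prob_density g \<longrightarrow> (\<forall>i<n. 0 < g (x i)) \<longrightarrow>
     H - 1 \<le> (\<Sum>i<n. ln (g (x i))) / real n \<longrightarrow>
     (\<forall>I. convex I \<longrightarrow>
        (\<Sum>i<n. indicator I (x i)) / real n \<le> (LINT y|lborel. f y * indicator I y) + 1 / 4) \<longrightarrow>
     (\<forall>y. g y \<le> C)"
    using log_concave_estimator_bounded[OF f(2) B, of "H - 1"] by blast
  \<comment> \<open>With \<open>\<kappa> = \<tau> / 4\<close> below, a squared Hellinger distance of
    at most \<open>2 * \<delta>\<close> gives an L1 distance of at most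
    \<open>3 * \<tau> / 4\<close>. The constants are chosen in the order \<open>C\<close>,
    \<open>\<epsilon>\<close>, \<open>\<eta>\<close>, so that each of the two error terms is at most
    \<open>\<delta>\<close>.\<close>
  define \<delta> where "\<delta> = \<tau>\<^sup>2 / 16"
  define \<epsilon> where "\<epsilon> = min 1 ((\<delta> / (2 * (Q + 1)))\<^sup>2)"
  have \<delta>: "0 < \<delta>" using \<tau> by (simp add: \<delta>_def)
  have \<epsilon>: "0 < \<epsilon>" "\<epsilon> \<le> 1" using \<delta> Q by (auto simp: \<epsilon>_def)
  have \<epsilon>Q: "2 * sqrt \<epsilon> * Q \<le> \<delta>"
  proof -
    have "sqrt \<epsilon> \<le> \<delta> / (2 * (Q + 1))"
      using \<delta> Q by (intro real_le_lsqrt) (auto simp: \<epsilon>_def)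
    then have "sqrt \<epsilon> * (2 * Q) \<le> \<delta> / (2 * (Q + 1)) * (2 * Q)" using Q by (intro mult_right_mono) auto
    also have "\<dots> \<le> \<delta>" using \<delta> Q by (simp add: field_simps)
    finally show ?thesis by simp
  qed
  define W where "W = 1 + 2 * ln ((C + 1) / \<epsilon>)"
  have W: "1 \<le> W" using C \<epsilon> by (simp add: W_def)
  \<comment> \<open>The cap 1/4 provides the hypotheses of the a priori bound
    \<open>C\<close>.\<close>
  define \<eta> where "\<eta> = min (1 / 4) (\<delta> / W)"
  have \<eta>: "0 < \<eta>" "\<eta> \<le> 1 / 4" "\<eta> * W \<le> \<delta>" using \<delta> W by (auto simp: \<eta>_def min_def field_simps)
  obtain \<J> where J: "finite \<J>" "\<J> \<subseteq> sets borel"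
    "\<And>I. convex I \<Longrightarrow> \<exists>J\<in>\<J>. I \<subseteq> J \<and>
       (LINT y|lborel. f y * indicator J y) \<le> (LINT y|lborel. f y * indicator I y) + \<eta> / 2"
    \<comment> \<open>Half of \<open>\<eta>\<close> is spent on bracketing, the other half on the
      empirical deviation of the brackets.\<close>
    using finite_bracketing_of_convex_sets[OF f(2) B, of "\<eta> / 2"] \<eta> by auto
  show ?thesis
  proof (rule that[of \<J> "\<eta> / 2"])
    fix n x \<phi>
    assume n: "0 < n" and mle: "is_log_concave_mle n x \<phi>" and pos: "\<And>i. i < n \<Longrightarrow> 0 < f (x i)"
      and EJ: "\<And>J. J \<in> \<J> \<Longrightarrow>
        (\<Sum>i<n. indicator J (x i)) / real n \<le> (LINT y|lborel. f y * indicator J y) + \<eta> / 2"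
      and EH: "(LINT y|lborel. f y * ln (f y)) - \<eta> / 2 \<le> (\<Sum>i<n. ln (f (x i))) / real n"
    define g where "g = (\<lambda>y. exp_ext (\<phi> y))"
    have g: "log_concave g" using mle by (auto simp: log_concave_def is_log_concave_mle_def g_def)
    have gd: "prob_density g" and gpos: "\<And>i. i < n \<Longrightarrow> 0 < g (x i)"
      and le: "(\<Sum>i<n. ln (f (x i))) \<le> (\<Sum>i<n. ln (g (x i)))"
      using log_concave_mle_properties[OF mle n f pos] by (auto simp: g_def)
    have "(\<Sum>i<n. ln (f (x i))) / real n \<le> (\<Sum>i<n. ln (g (x i))) / real n"
      using le by (intro divide_right_mono) auto
    then have lik: "H - \<eta> \<le> (\<Sum>i<n. ln (g (x i))) / real n" using EH \<eta> by (simp add: H_def)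
    have E: "(\<Sum>i<n. indicator I (x i)) / real n \<le> (LINT y|lborel. f y * indicator I y) + \<eta>"
      if I: "convex I" for I
    proof -
      obtain J where J': "J \<in> \<J>" "I \<subseteq> J"
        "(LINT y|lborel. f y * indicator J y) \<le> (LINT y|lborel. f y * indicator I y) + \<eta> / 2"
        using J(3)[OF I] by blast
      have "(\<Sum>i<n. indicator I (x i)) / real n \<le> (\<Sum>i<n. indicator J (x i) :: real) / real n"
        using J'(2) by (intro divide_right_mono sum_mono) (auto simp: indicator_def)
      then show ?thesis using EJ[OF J'(1)] J'(3) by linarith
    qed
    have "(\<Sum>i<n. indicator I (x i)) / real n \<le> (LINT y|lborel. f y * indicator I y) + 1 / 4"
      if "convex I" for I using E[OF that] \<eta>(2) by linarith
    moreover have "H - 1 \<le> (\<Sum>i<n. ln (g (x i))) / real n" using lik \<eta>(2) by linarith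
    ultimately have "g y \<le> C" for y using C(2) n g gd gpos by blast
    note hell = hellinger_log_concave_estimator[OF f(2) f_int g gd this C(1) \<epsilon> n \<eta>(1) gpos lik[unfolded H_def] E]
    have h: "(LINT y|lborel. (sqrt (f y) - sqrt (g y))\<^sup>2) \<le> 2 * \<delta>"
      using hell(2) \<epsilon>Q \<eta>(3) by (simp add: W_def Q_def)
    define \<kappa> where "\<kappa> = \<tau> / 4"
    have \<kappa>: "0 < \<kappa>" using \<tau> by (simp add: \<kappa>_def)
    note fd = prob_densityD[OF f(2)] and gd' = prob_densityD[OF gd]
    have "(LINT y|lborel. \<bar>g y - f y\<bar>)
       \<le> (LINT y|lborel. (sqrt (f y) - sqrt (g y))\<^sup>2 / (2 * \<kappa>) + \<kappa> * (f y + g y))"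
      using fd gd' hell(1) \<kappa> abs_diff_le_hellinger
      by (intro integral_mono) (auto simp: abs_minus_commute)
    also have "\<dots> = (LINT y|lborel. (sqrt (f y) - sqrt (g y))\<^sup>2) / (2 * \<kappa>) + 2 * \<kappa>"
      using fd gd' hell(1) by simp
    also have "\<dots> \<le> 2 * \<delta> / (2 * \<kappa>) + 2 * \<kappa>"
      using h \<kappa> by (intro add_right_mono divide_right_mono) auto
    also have "\<dots> \<le> \<tau>" using \<tau> by (simp add: \<delta>_def \<kappa>_def field_simps power2_eq_square)
    finally show "prob_density (\<lambda>y. exp_ext (\<phi> y)) \<and> (LINT y|lborel. \<bar>exp_ext (\<phi> y) - f y\<bar>) \<le> \<tau>"
      using gd by (simp add: g_def)
  qed (use J \<eta> in auto)
qed

subsection \<open>Convergence in probability\<close>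

lemma (in prob_space) expectation_square_sum_indep:
  fixes Z :: "'i \<Rightarrow> 'a \<Rightarrow> real"
  assumes "finite I" "indep_vars (\<lambda>_. borel) Z I"
    and "\<And>i. i \<in> I \<Longrightarrow> integrable M (Z i)" "\<And>i. i \<in> I \<Longrightarrow> integrable M (\<lambda>\<omega>. (Z i \<omega>)\<^sup>2)"
    and "\<And>i. i \<in> I \<Longrightarrow> expectation (Z i) = 0"
  shows "integrable M (\<lambda>\<omega>. (\<Sum>i\<in>I. Z i \<omega>)\<^sup>2) \<and>
    expectation (\<lambda>\<omega>. (\<Sum>i\<in>I. Z i \<omega>)\<^sup>2) = (\<Sum>i\<in>I. expectation (\<lambda>\<omega>. (Z i \<omega>)\<^sup>2))"
  using assms
proof (induction I rule: finite_induct)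
  case (insert i I)
  let ?S = "\<lambda>\<omega>. \<Sum>j\<in>I. Z j \<omega>"
  have IH: "integrable M (\<lambda>\<omega>. (?S \<omega>)\<^sup>2)"
    "expectation (\<lambda>\<omega>. (?S \<omega>)\<^sup>2) = (\<Sum>j\<in>I. expectation (\<lambda>\<omega>. (Z j \<omega>)\<^sup>2))"
    using insert.IH insert.prems indep_vars_subset[OF insert.prems(1), of I] by auto
  have ind: "indep_var borel (Z i) borel ?S"
    using insert.hyps insert.prems(1) by (rule indep_vars_sum)
  have int: "integrable M (Z i)" "integrable M ?S" using insert.prems by auto
  have cross: "integrable M (\<lambda>\<omega>. Z i \<omega> * ?S \<omega>)" using indep_var_integrable[OF ind int] .
  have "expectation (\<lambda>\<omega>. Z i \<omega> * ?S \<omega>) = 0"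
    using indep_var_lebesgue_integral[OF ind int] insert.prems by simp
  moreover have "(\<Sum>j\<in>insert i I. Z j \<omega>)\<^sup>2 = (Z i \<omega>)\<^sup>2 + 2 * (Z i \<omega> * ?S \<omega>) + (?S \<omega>)\<^sup>2" for \<omega>
    using insert.hyps by (simp add: power2_sum)
  ultimately show ?case using IH cross insert.prems insert.hyps by simp
qed simp

text \<open>Chebyshev's inequality with an explicit rate for each \<open>n\<close>. Only
  independence within one sample enters, so samples of different sizes may be related in any
  way.\<close>

lemma (in prob_space) weak_law_density:
  fixes Y :: "nat \<Rightarrow> 'a \<Rightarrow> real" and u :: "real \<Rightarrow> real"
  assumes n: "0 < n" and indep: "indep_vars (\<lambda>_. borel) Y {..<n}"
    and Y: "\<And>i. i < n \<Longrightarrow> distributed M lborel (Y i) (\<lambda>x. ennreal (f x))"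
    and f: "prob_density f" and u: "u \<in> borel_measurable borel"
    and u2: "integrable lborel (\<lambda>y. f y * (u y)\<^sup>2)" and \<eta>: "0 < \<eta>"
  shows "prob {\<omega> \<in> space M. \<eta> \<le> \<bar>(\<Sum>i<n. u (Y i \<omega>)) / real n - (LINT y|lborel. f y * u y)\<bar>}
     \<le> (LINT y|lborel. f y * (u y)\<^sup>2) / \<eta>\<^sup>2 / real n"
proof -
  note fd = prob_densityD[OF f]
  note [measurable] = fd(3) u
  define c where "c = (LINT y|lborel. f y * u y)"
  define V where "V = (LINT y|lborel. f y * (u y)\<^sup>2)"
  note u1 = integrable_density_of_second_moment[OF f u u2]
  define Z where "Z = (\<lambda>i \<omega>. u (Y i \<omega>) - c)"
  have ind: "indep_vars (\<lambda>_. borel) Z {..<n}"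
    unfolding Z_def by (rule indep_vars_compose2[OF indep, where Y = "\<lambda>_ y. u y - c"]) simp
  have Zm: "integrable M (Z i)" "integrable M (\<lambda>\<omega>. (Z i \<omega>)\<^sup>2)" "expectation (Z i) = 0"
    "expectation (\<lambda>\<omega>. (Z i \<omega>)\<^sup>2) \<le> V" if "i < n" for i
  proof -
    have 1: "integrable M (\<lambda>\<omega>. u (Y i \<omega>))"
      using distributed_integrable[OF Y[OF that], of u] u1 fd(1) by simp
    have 2: "integrable M (\<lambda>\<omega>. (u (Y i \<omega>))\<^sup>2)"
      using distributed_integrable[OF Y[OF that], of "\<lambda>y. (u y)\<^sup>2"] u2 fd(1) by simp
    have e1: "expectation (\<lambda>\<omega>. u (Y i \<omega>)) = c"
      using distributed_integral[OF Y[OF that], of u] fd(1) by (simp add: c_def)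
    have e2: "expectation (\<lambda>\<omega>. (u (Y i \<omega>))\<^sup>2) = V"
      using distributed_integral[OF Y[OF that], of "\<lambda>y. (u y)\<^sup>2"] fd(1) by (simp add: V_def)
    have sq: "(Z i \<omega>)\<^sup>2 = (u (Y i \<omega>))\<^sup>2 - 2 * c * u (Y i \<omega>) + c\<^sup>2" for \<omega>
      by (simp add: Z_def power2_diff algebra_simps)
    show "integrable M (Z i)" "expectation (Z i) = 0" using 1 e1 by (simp_all add: Z_def prob_space)
    show "integrable M (\<lambda>\<omega>. (Z i \<omega>)\<^sup>2)" "expectation (\<lambda>\<omega>. (Z i \<omega>)\<^sup>2) \<le> V"
      unfolding sq using 1 2 e1 e2 by (simp_all add: prob_space power2_eq_square)
  qed
  let ?S = "\<lambda>\<omega>. \<Sum>i<n. Z i \<omega>"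
  have S2: "integrable M (\<lambda>\<omega>. (?S \<omega>)\<^sup>2)"
    "expectation (\<lambda>\<omega>. (?S \<omega>)\<^sup>2) = (\<Sum>i<n. expectation (\<lambda>\<omega>. (Z i \<omega>)\<^sup>2))"
    using expectation_square_sum_indep[OF _ ind] Zm by auto
  have S1: "integrable M ?S" "expectation ?S = 0" using Zm by auto
  have "{\<omega> \<in> space M. \<eta> \<le> \<bar>(\<Sum>i<n. u (Y i \<omega>)) / real n - c\<bar>}
      = {\<omega> \<in> space M. real n * \<eta> \<le> \<bar>?S \<omega> - expectation ?S\<bar>}"
  proof -
    have "(\<Sum>i<n. u (Y i \<omega>)) / real n - c = ?S \<omega> / real n" for \<omega>
      using n by (simp add: Z_def sum_subtractf field_simps)
    then show ?thesis using n unfolding S1(2) by (auto simp: abs_div_pos[symmetric] field_simps)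
  qed
  then have "prob {\<omega> \<in> space M. \<eta> \<le> \<bar>(\<Sum>i<n. u (Y i \<omega>)) / real n - c\<bar>}
      \<le> variance ?S / (real n * \<eta>)\<^sup>2"
    using Chebyshev_inequality[of ?S "real n * \<eta>"] S1(1) S2(1) n \<eta> by auto
  also have "\<dots> \<le> (real n * V) / (real n * \<eta>)\<^sup>2"
  proof (rule divide_right_mono)
    have "variance ?S = (\<Sum>i<n. expectation (\<lambda>\<omega>. (Z i \<omega>)\<^sup>2))" using S1(2) S2(2) by simp
    also have "\<dots> \<le> (\<Sum>i<n. V)" using Zm(4) by (intro sum_mono) auto
    finally show "variance ?S \<le> real n * V" by simp
  qed simp
  also have "\<dots> = V / \<eta>\<^sup>2 / real n" using n by (simp add: power2_eq_square)
  finally show ?thesis by (simp add: c_def V_def)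
qed

lemma sup_dist_fun_le_L1:
  assumes g: "prob_density g" and f: "prob_density f"
  shows "\<bar>SUP x. \<bar>dist_fun g x - dist_fun f x\<bar>\<bar> \<le> (LINT y|lborel. \<bar>g y - f y\<bar>)"
proof -
  note gd = prob_densityD[OF g] and fd = prob_densityD[OF f]
  have le: "\<bar>dist_fun g x - dist_fun f x\<bar> \<le> (LINT y|lborel. \<bar>g y - f y\<bar>)" for x
  proof -
    note int = integrable_density_times_indicator[of _ "{..x}"]
    have eq: "dist_fun h x = (LINT y|lborel. h y * indicator {..x} y)" for h
      by (simp add: dist_fun_def set_lebesgue_integral_def mult.commute)
    have "dist_fun g x - dist_fun f x = (LINT y|lborel. (g y - f y) * indicator {..x} y)"
      using int[OF g] int[OF f]
      by (simp add: eq left_diff_distrib)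
    also have "\<bar>\<dots>\<bar> \<le> (LINT y|lborel. \<bar>(g y - f y) * indicator {..x} y\<bar>)"
      by (rule integral_abs_bound)
    also have "\<dots> \<le> (LINT y|lborel. \<bar>g y - f y\<bar>)"
    proof (rule integral_mono)
      have "integrable lborel (\<lambda>y. (g y - f y) * indicator {..x} y)"
        using int[OF g] int[OF f] by (simp add: left_diff_distrib)
      then show "integrable lborel (\<lambda>y. \<bar>(g y - f y) * indicator {..x} y\<bar>)" by simp
    qed (use gd fd in \<open>auto simp: indicator_def\<close>)
    finally show ?thesis .
  qed
  then have "(SUP x. \<bar>dist_fun g x - dist_fun f x\<bar>) \<le> (LINT y|lborel. \<bar>g y - f y\<bar>)"
    by (intro cSUP_least) auto
  \<comment> \<open>Boundedness is needed for the supremum to dominate one of its nonnegative terms,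
    hence to be nonnegative itself.\<close>
  moreover have "bdd_above (range (\<lambda>x. \<bar>dist_fun g x - dist_fun f x\<bar>))"
    using le by (auto simp: bdd_above_def)
  then have "\<bar>dist_fun g 0 - dist_fun f 0\<bar> \<le> (SUP x. \<bar>dist_fun g x - dist_fun f x\<bar>)"
    by (intro cSUP_upper) auto
  ultimately show ?thesis by linarith
qed

text \<open>Measurability of the estimator in \<open>\<omega>\<close> is not assumed, so the bad
  event is covered by measurable sets: a null set and finitely many deviation events of total
  probability at most \<open>K / n\<close>.\<close>

lemma (in prob_space) outer_measure_L1_error_tendsto_0:
  fixes X :: "nat \<Rightarrow> nat \<Rightarrow> 'a \<Rightarrow> real" and \<phi> :: "nat \<Rightarrow> 'a \<Rightarrow> real \<Rightarrow> ereal"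
  assumes f: "log_concave f" "prob_density f"
    and indep: "\<And>n. n > 1 \<Longrightarrow> indep_vars (\<lambda>_. borel) (X n) {..<n}"
    and dist: "\<And>n i. n > 1 \<Longrightarrow> i < n \<Longrightarrow> distributed M lborel (X n i) (\<lambda>x. ennreal (f x))"
    and mle: "\<And>n. n > 1 \<Longrightarrow> AE \<omega> in M. is_log_concave_mle n (\<lambda>i. X n i \<omega>) (\<phi> n \<omega>)"
    and \<tau>: "0 < \<tau>"
  shows "(\<lambda>n. outer_measure_of M {\<omega> \<in> space M. \<not> (prob_density (\<lambda>y. exp_ext (\<phi> n \<omega> y)) \<and>
      (LINT y|lborel. \<bar>exp_ext (\<phi> n \<omega> y) - f y\<bar>) \<le> \<tau>)}) \<longlonglongrightarrow> 0"
    (is "(\<lambda>n. outer_measure_of M (?bad n)) \<longlonglongrightarrow> 0")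
proof -
  note [measurable] = prob_densityD(3)[OF f(2)]
  obtain \<J> :: "real set set" and \<eta> where J: "finite \<J>" "\<J> \<subseteq> sets borel" and \<eta>: "0 < \<eta>"
    and stab: "\<And>n x \<phi>. \<lbrakk>0 < n; is_log_concave_mle n x \<phi>; \<And>i. i < n \<Longrightarrow> 0 < f (x i);
       \<And>J. J \<in> \<J> \<Longrightarrow> (\<Sum>i<n. indicator J (x i)) / real n \<le> (LINT y|lborel. f y * indicator J y) + \<eta>;
       (LINT y|lborel. f y * ln (f y)) - \<eta> \<le> (\<Sum>i<n. ln (f (x i))) / real n\<rbrakk>
     \<Longrightarrow> prob_density (\<lambda>y. exp_ext (\<phi> y)) \<and> (LINT y|lborel. \<bar>exp_ext (\<phi> y) - f y\<bar>) \<le> \<tau>"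
    using log_concave_mle_L1_stability[OF f \<tau>] by blast
  \<comment> \<open>The finitely many test functions whose sample averages have to be close to their
    means.\<close>
  define U :: "(real \<Rightarrow> real) set" where "U = insert (\<lambda>y. ln (f y)) (indicator ` \<J>)"
  have U: "finite U" using J by (simp add: U_def)
  have Um: "u \<in> borel_measurable borel" and U2: "integrable lborel (\<lambda>y. f y * (u y)\<^sup>2)" if "u \<in> U" for u
  proof -
    consider "u = (\<lambda>y. ln (f y))" | J where "u = indicator J" "J \<in> sets borel"
      using \<open>u \<in> U\<close> J(2) by (auto simp: U_def)
    then have "u \<in> borel_measurable borel \<and> integrable lborel (\<lambda>y. f y * (u y)\<^sup>2)"
    proof cases
      case 1
      then show ?thesis using log_concave_density_bounds[OF f] by auto
    next
      case 2
      then show ?thesis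
        using integrable_density_times_bounded[OF f(2), of "\<lambda>y. (u y)\<^sup>2" 1] by (auto simp: indicator_def)
    qed
    then show "u \<in> borel_measurable borel" "integrable lborel (\<lambda>y. f y * (u y)\<^sup>2)" by auto
  qed
  define K where "K = (\<Sum>u\<in>U. (LINT y|lborel. f y * (u y)\<^sup>2) / \<eta>\<^sup>2)"
  have bound: "outer_measure_of M (?bad n) \<le> ennreal (K / real n)" if n: "1 < n" for n
  proof -
    define D where "D = (\<lambda>u. {\<omega> \<in> space M. \<eta> \<le> \<bar>(\<Sum>i<n. u (X n i \<omega>)) / real n - (LINT y|lborel. f y * u y)\<bar>})"
    have X: "X n i \<in> borel_measurable M" if "i < n" for i
      using distributed_measurable[OF dist[OF n that]] by simp
    have Db: "D u \<in> sets M" if "u \<in> U" for u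
    proof -
      have "(\<lambda>\<omega>. u (X n i \<omega>)) \<in> borel_measurable M" if "i < n" for i
        using measurable_compose[OF X[OF that] Um[OF \<open>u \<in> U\<close>]] .
      then have [measurable]: "(\<lambda>\<omega>. \<Sum>i<n. u (X n i \<omega>)) \<in> borel_measurable M"
        by (intro borel_measurable_sum) auto
      show ?thesis unfolding D_def by measurable
    qed
    \<comment> \<open>The zero set of \<open>f\<close> is null for the distribution with density
      \<open>f\<close>.\<close>
    have pos: "AE \<omega> in M. 0 < f (X n i \<omega>)" if "i < n" for i
    proof -
      have "AE y in density lborel (\<lambda>y. ennreal (f y)). 0 < f y"
        by (subst AE_density) auto
      then have "AE y in distr M lborel (X n i). 0 < f y"
        by (subst distributed_distr_eq_density[OF dist[OF n that]])
      with distributed_measurable[OF dist[OF n that]] show ?thesis by (rule AE_distrD)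
    qed
    have "AE \<omega> in M. is_log_concave_mle n (\<lambda>i. X n i \<omega>) (\<phi> n \<omega>) \<and> (\<forall>i\<in>{..<n}. 0 < f (X n i \<omega>))"
      using mle[OF n] pos by (intro AE_conjI AE_finite_allI) auto
    then obtain N where N: "{\<omega> \<in> space M. \<not> (is_log_concave_mle n (\<lambda>i. X n i \<omega>) (\<phi> n \<omega>) \<and>
        (\<forall>i\<in>{..<n}. 0 < f (X n i \<omega>)))} \<subseteq> N" "emeasure M N = 0" "N \<in> sets M"
      by (rule AE_E)
    have sub: "?bad n \<subseteq> N \<union> (\<Union>u\<in>U. D u)"
    proof (rule subsetI, rule ccontr)
      fix \<omega> assume \<omega>: "\<omega> \<in> ?bad n" "\<omega> \<notin> N \<union> (\<Union>u\<in>U. D u)"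
      have close: "\<bar>(\<Sum>i<n. u (X n i \<omega>)) / real n - (LINT y|lborel. f y * u y)\<bar> < \<eta>" if "u \<in> U" for u
        using \<omega> that by (auto simp: D_def)
      have "prob_density (\<lambda>y. exp_ext (\<phi> n \<omega> y)) \<and> (LINT y|lborel. \<bar>exp_ext (\<phi> n \<omega> y) - f y\<bar>) \<le> \<tau>"
      proof (rule stab)
        show "0 < n" using n by simp
        show "is_log_concave_mle n (\<lambda>i. X n i \<omega>) (\<phi> n \<omega>)" using \<omega> N(1) by auto
        show "0 < f (X n i \<omega>)" if "i < n" for i using \<omega> N(1) that by auto
        show "(\<Sum>i<n. indicator J (X n i \<omega>)) / real n \<le> (LINT y|lborel. f y * indicator J y) + \<eta>"
          if "J \<in> \<J>" for J
        proof -
          have "indicator J \<in> U" using that by (simp add: U_def)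
          from close[OF this] show ?thesis by linarith
        qed
        have "(\<lambda>y. ln (f y)) \<in> U" by (simp add: U_def)
        from close[OF this]
        show "(LINT y|lborel. f y * ln (f y)) - \<eta> \<le> (\<Sum>i<n. ln (f (X n i \<omega>))) / real n"
          by linarith
      qed
      then show False using \<omega> by simp
    qed
    have DU: "(\<Union>u\<in>U. D u) \<in> sets M" using U Db by auto
    have "outer_measure_of M (?bad n) \<le> outer_measure_of M (N \<union> (\<Union>u\<in>U. D u))"
      using sub by (rule outer_measure_of_mono)
    also have "\<dots> = emeasure M (N \<union> (\<Union>u\<in>U. D u))" using N DU by simp
    also have "\<dots> \<le> emeasure M N + emeasure M (\<Union>u\<in>U. D u)" using N DU by (intro emeasure_subadditive) auto
    also have "\<dots> = emeasure M (\<Union>u\<in>U. D u)" using N by simp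
    also have "\<dots> \<le> (\<Sum>u\<in>U. emeasure M (D u))"
      using U Db by (intro emeasure_subadditive_finite) auto
    also have "\<dots> = ennreal (\<Sum>u\<in>U. prob (D u))" by (simp add: emeasure_eq_measure)
    also have "\<dots> \<le> ennreal (K / real n)"
    proof (rule ennreal_leI)
      have "(\<Sum>u\<in>U. prob (D u)) \<le> (\<Sum>u\<in>U. (LINT y|lborel. f y * (u y)\<^sup>2) / \<eta>\<^sup>2 / real n)"
        unfolding D_def using n Um U2
        by (intro sum_mono weak_law_density[OF _ indep[OF n] dist[OF n] f(2) _ _ \<eta>]) auto
      then show "(\<Sum>u\<in>U. prob (D u)) \<le> K / real n" by (simp add: K_def sum_divide_distrib)
    qed
    finally show ?thesis .
  qed
  have "(\<lambda>n. ennreal (K / real n)) \<longlonglongrightarrow> ennreal 0"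
    by (intro tendsto_ennrealI lim_const_over_n)
  then have lim: "(\<lambda>n. ennreal (K / real n)) \<longlonglongrightarrow> 0" by simp
  show ?thesis
  proof (rule tendsto_sandwich[OF _ _ tendsto_const lim])
    show "\<forall>\<^sub>F n in sequentially. outer_measure_of M (?bad n) \<le> ennreal (K / real n)"
      using eventually_gt_at_top[of 1] by eventually_elim (rule bound)
  qed auto
qed

theorem corollary4p2:
  fixes M :: "'a measure"
    and f :: "real \<Rightarrow> real"
    and X :: "nat \<Rightarrow> nat \<Rightarrow> 'a \<Rightarrow> real"
    and phihat :: "nat \<Rightarrow> 'a \<Rightarrow> real \<Rightarrow> ereal"
    and fhat :: "nat \<Rightarrow> 'a \<Rightarrow> real \<Rightarrow> real"
  assumes "prob_space M"
    and "log_concave f"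
    and "prob_density f"
    and "\<And>n. n > 1 \<Longrightarrow> prob_space.indep_vars M (\<lambda>_. borel) (X n) {..<n}"
    and "\<And>n i. n > 1 \<Longrightarrow> i < n \<Longrightarrow> distributed M lborel (X n i) (\<lambda>x. ennreal (f x))"
    and "\<And>n. n > 1 \<Longrightarrow> AE \<omega> in M. is_log_concave_mle n (\<lambda>i. X n i \<omega>) (phihat n \<omega>)"
    and "\<And>n \<omega> x. fhat n \<omega> x = exp_ext (phihat n \<omega> x)"
  shows "tendsto_in_prob M (\<lambda>n \<omega>. LINT x|lborel. \<bar>fhat n \<omega> x - f x\<bar>) 0 \<and>
         tendsto_in_prob M (\<lambda>n \<omega>. SUP x. \<bar>dist_fun (fhat n \<omega>) x - dist_fun f x\<bar>) 0"
proof -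
  let ?bad = "\<lambda>\<tau> n. {\<omega> \<in> space M. \<not> (prob_density (fhat n \<omega>) \<and> (LINT x|lborel. \<bar>fhat n \<omega> x - f x\<bar>) \<le> \<tau>)}"
  have fhat: "fhat n \<omega> = (\<lambda>x. exp_ext (phihat n \<omega> x))" for n \<omega> using assms(7) by blast
  have bad: "(\<lambda>n. outer_measure_of M (?bad \<tau> n)) \<longlonglongrightarrow> 0" if "0 < \<tau>" for \<tau>
    unfolding fhat
    using prob_space.outer_measure_L1_error_tendsto_0[OF assms(1-3), of X phihat \<tau>] assms(4-6) that by blast
  \<comment> \<open>Any statistic dominated by the L1 distance whenever the estimator is a density
    exceeds \<open>\<epsilon>\<close> only on the bad set; both claims are instances.\<close>
  have "tendsto_in_prob M Z 0"
    if Z: "\<And>n \<omega>. prob_density (fhat n \<omega>) \<Longrightarrow> \<bar>Z n \<omega>\<bar> \<le> (LINT x|lborel. \<bar>fhat n \<omega> x - f x\<bar>)"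
    for Z :: "nat \<Rightarrow> 'a \<Rightarrow> real"
    unfolding tendsto_in_prob_def
  proof (intro allI impI)
    fix \<epsilon> :: real assume "0 < \<epsilon>"
    have "{\<omega> \<in> space M. \<epsilon> < \<bar>Z n \<omega> - 0\<bar>} \<subseteq> ?bad \<epsilon> n" for n
      using Z by (auto simp: not_le) (meson less_le_trans)
    then show "(\<lambda>n. outer_measure_of M {\<omega> \<in> space M. \<epsilon> < \<bar>Z n \<omega> - 0\<bar>}) \<longlonglongrightarrow> 0"
      by (intro tendsto_sandwich[OF _ _ tendsto_const bad[OF \<open>0 < \<epsilon>\<close>]] always_eventually allI
          outer_measure_of_mono) auto
  qed
  then show ?thesis using sup_dist_fun_le_L1[OF _ assms(3)] by simp
qed

end
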